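(* Consider a combinatorial problem with ground set $\mathcal{U}$ and feasible family $\mathcal{F}$. If there is a polynomial-time $\alpha$-approximation algorithm ($\alpha\ge1$) for the min-sum problem $\min_{S\in\mathcal{F}}\sum_{e\in S}v_e$ (for arbitrary nonnegative values), then for any positive constant $\epsilon$ there is a polynomial-time $\alpha(1+\epsilon)$-approximation algorithm for the ordered-norm minimization problem $\min_{S\in\mathcal{F}}\mathrm{ord}_{\boldsymbol{w}}(\boldsymbol{v}[S])$.
   Context: For a non-increasing nonnegative weight vector $\boldsymbol{w}$, the ordered norm is $\mathrm{ord}_{\boldsymbol{w}}(x)=\boldsymbol{w}^\top |x|^{\downarrow}$, where $|x|^\downarrow$ is the vector of absolute values of $x$ sorted non-increasingly. $\boldsymbol{v}[S]$ has entries $v_e\mathbf{1}[e\in S]$, $\boldsymbol{v}\ge0$. *)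

theory Defs
  imports
    Complex_Main
    "HOL-Library.Log_Nat"
    "HOL-Library.Multiset"
    "HOL-Computational_Algebra.Polynomial"
begin

section \<open>Polynomial time\<close>

text \<open>
  The machine model is a structured while language whose finitely many variables hold
  S-expressions with integer atoms. Time is logarithmic cost: evaluating an expression
  costs the bit size of the value of every one of its subexpressions, so arithmetic
  on long numbers and copying of long values are charged for their length. Under this measure the model and
  multitape Turing machines simulate each other with polynomial overhead.
\<close>

datatype data = Atom int | Node data data

fun dsize :: "data \<Rightarrow> nat" where
  "dsize (Atom i) = 1 + floorlog 2 (nat \<bar>i\<bar>)"
| "dsize (Node a b) = 1 + dsize a + dsize b"

type_synonym store = "nat \<Rightarrow> data"

datatype exp =
    Const int
  | Var nat
  | MkNode exp exp
  | Fst exp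
  | Snd exp
  | IsNode exp
  | Eq exp exp
  | Less exp exp
  | Add exp exp
  | Sub exp exp
  | Mul exp exp
  | Div exp exp

text \<open>Operations applied to data of the wrong shape read it as the atom \<open>0\<close>.\<close>

fun dint :: "data \<Rightarrow> int" where
  "dint (Atom i) = i"
| "dint (Node a b) = 0"

fun dfst :: "data \<Rightarrow> data" where
  "dfst (Atom i) = Atom 0"
| "dfst (Node a b) = a"

fun dsnd :: "data \<Rightarrow> data" where
  "dsnd (Atom i) = Atom 0"
| "dsnd (Node a b) = b"

fun is_node :: "data \<Rightarrow> bool" where
  "is_node (Atom i) = False"
| "is_node (Node a b) = True"

fun eval :: "exp \<Rightarrow> store \<Rightarrow> data" where
  "eval (Const i) s = Atom i"
| "eval (Var x) s = s x"
| "eval (MkNode e f) s = Node (eval e s) (eval f s)"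
| "eval (Fst e) s = dfst (eval e s)"
| "eval (Snd e) s = dsnd (eval e s)"
| "eval (IsNode e) s = Atom (of_bool (is_node (eval e s)))"
| "eval (Eq e f) s = Atom (of_bool (eval e s = eval f s))"
| "eval (Less e f) s = Atom (of_bool (dint (eval e s) < dint (eval f s)))"
| "eval (Add e f) s = Atom (dint (eval e s) + dint (eval f s))"
| "eval (Sub e f) s = Atom (dint (eval e s) - dint (eval f s))"
| "eval (Mul e f) s = Atom (dint (eval e s) * dint (eval f s))"
| "eval (Div e f) s = Atom (dint (eval e s) div dint (eval f s))"

fun etime :: "exp \<Rightarrow> store \<Rightarrow> nat" where
  "etime (Const i) s = dsize (Atom i)"
| "etime (Var x) s = dsize (s x)"
| "etime (MkNode e f) s = etime e s + etime f s + dsize (eval (MkNode e f) s)"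
| "etime (Fst e) s = etime e s + dsize (eval (Fst e) s)"
| "etime (Snd e) s = etime e s + dsize (eval (Snd e) s)"
| "etime (IsNode e) s = etime e s + dsize (eval (IsNode e) s)"
| "etime (Eq e f) s = etime e s + etime f s + dsize (eval (Eq e f) s)"
| "etime (Less e f) s = etime e s + etime f s + dsize (eval (Less e f) s)"
| "etime (Add e f) s = etime e s + etime f s + dsize (eval (Add e f) s)"
| "etime (Sub e f) s = etime e s + etime f s + dsize (eval (Sub e f) s)"
| "etime (Mul e f) s = etime e s + etime f s + dsize (eval (Mul e f) s)"
| "etime (Div e f) s = etime e s + etime f s + dsize (eval (Div e f) s)"

datatype com =
    Skip
  | Assign nat exp
  | Seq com com
  | Cond exp com com
  | While exp com

text \<open>\<open>exec c s t s'\<close>: started in \<open>s\<close>, the program \<open>c\<close> halts after time \<open>t\<close> in \<open>s'\<close>.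
  A test succeeds iff its value is not the atom \<open>0\<close>.\<close>

inductive exec :: "com \<Rightarrow> store \<Rightarrow> nat \<Rightarrow> store \<Rightarrow> bool" where
  Skip: "exec Skip s 1 s"
| Assign: "exec (Assign x e) s (1 + etime e s) (s(x := eval e s))"
| Seq: "exec c s t s' \<Longrightarrow> exec d s' u s'' \<Longrightarrow> exec (Seq c d) s (t + u) s''"
| CondTrue: "eval e s \<noteq> Atom 0 \<Longrightarrow> exec c s t s' \<Longrightarrow> exec (Cond e c d) s (1 + etime e s + t) s'"
| CondFalse: "eval e s = Atom 0 \<Longrightarrow> exec d s t s' \<Longrightarrow> exec (Cond e c d) s (1 + etime e s + t) s'"
| WhileFalse: "eval e s = Atom 0 \<Longrightarrow> exec (While e c) s (1 + etime e s) s"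
| WhileTrue: "eval e s \<noteq> Atom 0 \<Longrightarrow> exec c s t s' \<Longrightarrow> exec (While e c) s' u s'' \<Longrightarrow>
    exec (While e c) s (1 + etime e s + t + u) s''"

inductive_cases exec_SkipE: "exec Skip s t s'"
inductive_cases exec_AssignE: "exec (Assign x e) s t s'"
inductive_cases exec_SeqE: "exec (Seq c d) s t s'"
inductive_cases exec_CondE: "exec (Cond e c d) s t s'"
inductive_cases exec_WhileE: "exec (While e c) s t s'"

lemma exec_deterministic:
  assumes "exec c s t s'" and "exec c s u s''"
  shows "t = u \<and> s' = s''"
  using assms
proof (induction arbitrary: u s'' rule: exec.induct)
  case (Skip s)
  then show ?case by (auto elim: exec_SkipE)
next
  case (Assign x e s)
  then show ?case by (auto elim: exec_AssignE)
next
  case (Seq c s t s1 d t' s2)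
  from Seq.prems obtain a m b where "exec c s a m" "exec d m b s''" "u = a + b"
    by (elim exec_SeqE) blast
  with Seq.IH show ?case by blast
next
  case (CondTrue e s c t s1 d)
  from CondTrue.prems CondTrue.hyps(1) obtain a where "exec c s a s''" "u = 1 + etime e s + a"
    by (elim exec_CondE) auto
  with CondTrue.IH show ?case by blast
next
  case (CondFalse e s d t s1 c)
  from CondFalse.prems CondFalse.hyps(1) obtain a where "exec d s a s''" "u = 1 + etime e s + a"
    by (elim exec_CondE) auto
  with CondFalse.IH show ?case by blast
next
  case (WhileFalse e s c)
  from WhileFalse.prems show ?case
    by (rule exec_WhileE) (use WhileFalse.hyps(1) in auto)
next
  case (WhileTrue e s c t s1 t' s2)
  from WhileTrue.prems obtain a m b
    where "exec c s a m" "exec (While e c) m b s''" "u = 1 + etime e s + a + b"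
    by (rule exec_WhileE) (use WhileTrue.hyps(1) in auto)
  with WhileTrue.IH show ?case by blast
qed

text \<open>Variable \<open>0\<close> holds the input at the start and the output at the end.\<close>

definition computes :: "com \<Rightarrow> data \<Rightarrow> nat \<Rightarrow> data \<Rightarrow> bool" where
  "computes c inp t out \<longleftrightarrow> (\<exists>s. exec c ((\<lambda>_. Atom 0)(0 := inp)) t s \<and> s 0 = out)"

section \<open>Encodings\<close>

fun enc_list :: "data list \<Rightarrow> data" where
  "enc_list [] = Atom 0"
| "enc_list (d # ds) = Node d (enc_list ds)"

definition enc_rat :: "rat \<Rightarrow> data" where
  "enc_rat r = (case quotient_of r of (p, q) \<Rightarrow> Node (Atom p) (Atom q))"

definition enc_values :: "data list \<Rightarrow> (data \<Rightarrow> rat) \<Rightarrow> data" where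
  "enc_values us v = enc_list (map (\<lambda>e. Node e (enc_rat (v e))) us)"

definition encodes_set :: "data \<Rightarrow> data set \<Rightarrow> bool" where
  "encodes_set d S \<longleftrightarrow> (\<exists>xs. distinct xs \<and> set xs = S \<and> d = enc_list xs)"

section \<open>Approximation algorithms\<close>

text \<open>
  A minimization problem is given by its set of instances: encoded input, feasible family,
  objective function. The algorithm must respect the time bound on every instance; if the
  feasible family is empty, nothing is required of the output.
\<close>

type_synonym min_problem = "(data \<times> data set set \<times> (data set \<Rightarrow> rat)) set"

definition polytime_approx :: "real \<Rightarrow> min_problem \<Rightarrow> com \<Rightarrow> bool" where
  "polytime_approx \<alpha> Q c \<longleftrightarrow>
    (\<exists>p :: nat poly. \<forall>(inp, F, cost) \<in> Q. \<exists>t out.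
      computes c inp t out \<and> t \<le> poly p (dsize inp) \<and>
      (F \<noteq> {} \<longrightarrow>
        (\<exists>S\<in>F. encodes_set out S \<and> real_of_rat (cost S) \<le> \<alpha> * real_of_rat (Min (cost ` F)))))"

section \<open>Combinatorial problems, min-sum and ordered-norm objectives\<close>

text \<open>
  Each instance \<open>x\<close> determines a ground set and a feasible family, which need not be
  given explicitly; instances and elements are arbitrary finite data. The nonnegative values
  and weights are rational, so that they have a finite encoding.
\<close>

record comb_problem =
  instances :: "data set"
  ground :: "data \<Rightarrow> data set"
  feasible :: "data \<Rightarrow> data set set"

definition combinatorial_problem :: "comb_problem \<Rightarrow> bool" where
  "combinatorial_problem P \<longleftrightarrow>
    (\<forall>x\<in>instances P. finite (ground P x) \<and> feasible P x \<subseteq> Pow (ground P x))"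

definition restrict_vec :: "('e \<Rightarrow> rat) \<Rightarrow> 'e set \<Rightarrow> 'e \<Rightarrow> rat" where
  "restrict_vec v S = (\<lambda>e. v e * of_bool (e \<in> S))"

definition abs_desc :: "'e set \<Rightarrow> ('e \<Rightarrow> rat) \<Rightarrow> rat list" where
  "abs_desc U x = rev (sorted_list_of_multiset (image_mset (\<lambda>e. \<bar>x e\<bar>) (mset_set U)))"

definition weight_vector :: "nat \<Rightarrow> rat list \<Rightarrow> bool" where
  "weight_vector n w \<longleftrightarrow> length w = n \<and> sorted_wrt (\<ge>) w \<and> (\<forall>a\<in>set w. 0 \<le> a)"

definition ord_norm :: "'e set \<Rightarrow> rat list \<Rightarrow> ('e \<Rightarrow> rat) \<Rightarrow> rat" where
  "ord_norm U w x = (\<Sum>i<card U. w ! i * abs_desc U x ! i)"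

definition min_sum_problem :: "comb_problem \<Rightarrow> min_problem" where
  "min_sum_problem P =
    {(Node x (enc_values us v), feasible P x, \<lambda>S. \<Sum>e\<in>S. v e) | x us v.
      x \<in> instances P \<and> distinct us \<and> set us = ground P x \<and> (\<forall>e\<in>ground P x. 0 \<le> v e)}"

definition ord_norm_problem :: "comb_problem \<Rightarrow> min_problem" where
  "ord_norm_problem P =
    {(Node x (Node (enc_values us v) (enc_list (map enc_rat w))), feasible P x,
      \<lambda>S. ord_norm (ground P x) w (restrict_vec v S)) | x us v w.
      x \<in> instances P \<and> distinct us \<and> set us = ground P x \<and> (\<forall>e\<in>ground P x. 0 \<le> v e) \<and>
      weight_vector (card (ground P x)) w}"

end

(* For integers k >= 4/epsilon and scaled (hence integral) values and weights, put
   c_i = w_i - w_(i+1). The ordered norm of S is sum_i c_i Top_i(S), where Top_i(S), the sum of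
   the i largest values in S, is at most i t_i + sum_(e in S) max 0 (v_e - t_i) for every
   threshold t_i, with equality if t_i is the i-th largest value. Hence every sequence t bounds the
   norm by a constant plus a min-sum objective with penalties sum_i c_i max 0 (v_e - t_i) >= 0.
   For an optimal S it suffices that t is constant on blocks of ranks that grow by the factor 1 + 1/k and
   that t_i lies on a geometric grid of ratio 1 + 1/k between the largest value M in S and
   M / (k n); all of these bounds together lose a factor of at most (1 + 1/k)^2 + 1/k. There are
   only O(k log n + k^2) blocks and grid points, so a monotone sequence is a bit string of this
   length, and all pairs of M and such a string can be tried in polynomial time. *)

theory Submission imports Defs begin

section \<open>Sizes and execution\<close>

text \<open>The running time is a claim about concrete programs, so much of the work is a calculus
  \<open>ptime D f\<close> of polynomial-time functions, closed under composition, pairing, case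
  distinction and size-bounded folds; the algorithm can then be written as an ordinary function. The
  promise set \<open>D\<close> is forced by the min-sum program, which is only known to halt on
  valid inputs. Scaling to integers avoids rational arithmetic, and an integral penalty is a
  fraction with denominator \<open>1\<close>, so every guess yields a legal min-sum input. The
  algorithm never evaluates an ordered norm: it compares the upper bounds certified by the guesses,
  so a poor guess can only overestimate. The min-sum program loses \<alpha> only on the penalty part
  of a bound; the constant part is nonnegative and absorbs the same factor because \<alpha> \<ge> 1.
  Of the remaining loss, one factor 1 + 1/k comes from the grid and one from the blocks. The term
  1/k comes from stopping the grid at M / (k n): this error occurs at most n times and is paid for
  by M, a summand of every Top_i(S).\<close>

lemma floorlog2_less: "n < 2 ^ floorlog 2 n"
proof (cases "n = 0")
  case True
  then show ?thesis by (simp add: floorlog_def)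
next
  case False
  then show ?thesis using floorlog_bounds[of n 2] by simp
qed

lemma dsize_ge1: "1 \<le> dsize d"
  by (cases d) auto

lemma dsize_Atom_le: "nat \<bar>i\<bar> < 2 ^ w \<Longrightarrow> dsize (Atom i) \<le> 1 + w"
  by (simp add: floorlog_leI)

lemma dsize_Atom_mono: "\<bar>i\<bar> \<le> \<bar>j\<bar> \<Longrightarrow> dsize (Atom i) \<le> dsize (Atom j)"
  by (auto intro!: floorlog_mono)

text \<open>Each \<open>dsize\<close> contains a summand \<open>1\<close>; the second of them pays
  for the carry bit.\<close>

lemma dsize_add: "dsize (Atom (i + j)) \<le> dsize (Atom i) + dsize (Atom j)"
proof -
  let ?a = "floorlog 2 (nat \<bar>i\<bar>)" and ?b = "floorlog 2 (nat \<bar>j\<bar>)"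
  have "nat \<bar>i + j\<bar> \<le> nat \<bar>i\<bar> + nat \<bar>j\<bar>" by linarith
  also have "\<dots> < 2 ^ ?a + 2 ^ ?b" using floorlog2_less by (rule add_strict_mono) (rule floorlog2_less)
  also have "\<dots> \<le> 2 ^ (?a + ?b) + (2::nat) ^ (?a + ?b)" by (intro add_mono power_increasing) auto
  also have "\<dots> = 2 ^ (1 + ?a + ?b)" by simp
  finally have "dsize (Atom (i + j)) \<le> 1 + (1 + ?a + ?b)" by (rule dsize_Atom_le)
  then show ?thesis by simp
qed

lemma dsize_uminus [simp]: "dsize (Atom (- i)) = dsize (Atom i)"
  by simp

lemma dsize_diff: "dsize (Atom (i - j)) \<le> dsize (Atom i) + dsize (Atom j)"
  using dsize_add[of i "- j"] by simp

lemma dsize_mult: "dsize (Atom (i * j)) \<le> dsize (Atom i) + dsize (Atom j)"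
proof -
  let ?a = "floorlog 2 (nat \<bar>i\<bar>)" and ?b = "floorlog 2 (nat \<bar>j\<bar>)"
  have "nat \<bar>i * j\<bar> = nat \<bar>i\<bar> * nat \<bar>j\<bar>" by (simp add: abs_mult nat_mult_distrib)
  also have "\<dots> < 2 ^ ?a * 2 ^ ?b"
    using floorlog2_less by (intro mult_strict_mono) (auto simp: floorlog2_less)
  finally have "dsize (Atom (i * j)) \<le> 1 + (?a + ?b)" by (intro dsize_Atom_le) (simp add: power_add)
  then show ?thesis by simp
qed

lemma abs_div_le: "\<bar>i div j\<bar> \<le> \<bar>i :: int\<bar>"
proof (cases "j = 0")
  case False
  have *: "\<bar>i div m\<bar> \<le> \<bar>i\<bar>" if "0 < m" for i m :: int
  proof (cases "0 \<le> i")
    case True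
    then show ?thesis using that by (simp add: div_int_pos_iff zdiv_mono2[of i 1 m, simplified])
  next
    case False
    then have "i \<le> i div m" using zdiv_mono2_neg[of i 1 m] that by simp
    moreover have "i div m \<le> 0" using False that by (simp add: div_nonpos_pos_le0)
    ultimately show ?thesis using False by simp
  qed
  show ?thesis
  proof (cases "0 < j")
    case False
    with \<open>j \<noteq> 0\<close> have "0 < - j" by simp
    from *[OF this, of "- i"] show ?thesis by (simp add: div_minus_minus)
  qed (use * in blast)
qed simp

lemma dsize_div: "dsize (Atom (i div j)) \<le> dsize (Atom i)"
  by (rule dsize_Atom_mono) (rule abs_div_le)

lemma dsize_dint: "dsize (Atom (dint d)) \<le> dsize d"
  by (cases d) (auto simp: floorlog_def)

lemma dsize_dfst: "dsize (dfst d) \<le> dsize d"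
  by (cases d) (auto simp: floorlog_def)

lemma dsize_dsnd: "dsize (dsnd d) \<le> dsize d"
  by (cases d) (auto simp: floorlog_def)

lemma dsize_of_bool: "dsize (Atom (of_bool b)) \<le> 2"
  using dsize_Atom_le[of "of_bool b" 1] by (cases b) auto

lemma dsize_eval_le_etime: "dsize (eval e s) \<le> etime e s"
  by (cases e) auto

text \<open>Every operation, even multiplication in this logarithmic measure, yields a result whose
  size is at most the sum of the operand sizes up to a constant, and a value is never larger than
  the time spent on it. The constant may grow with \<open>e\<close>, which is fixed.\<close>

lemma etime_linear: "\<exists>C. \<forall>d. etime e (\<lambda>_. d) \<le> C * dsize d"
proof -
  have step: "\<exists>C. \<forall>d. etime g (\<lambda>_. d) \<le> C * dsize d"
    if e: "\<exists>C. \<forall>d. etime e (\<lambda>_. d) \<le> C * dsize d"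
      and f: "\<exists>C. \<forall>d. etime f (\<lambda>_. d) \<le> C * dsize d"
      and g: "\<And>d. etime g (\<lambda>_. d) \<le> 2 * etime e (\<lambda>_. d) + 2 * etime f (\<lambda>_. d) + 2" for e f g
  proof -
    from e f obtain A B where A: "\<And>d. etime e (\<lambda>_. d) \<le> A * dsize d"
      and B: "\<And>d. etime f (\<lambda>_. d) \<le> B * dsize d" by blast
    have "etime g (\<lambda>_. d) \<le> (2 * A + 2 * B + 2) * dsize d" for d
    proof -
      have "etime g (\<lambda>_. d) \<le> 2 * (A * dsize d) + 2 * (B * dsize d) + 2 * dsize d"
        using g[of d] A[of d] B[of d] dsize_ge1[of d] by linarith
      then show ?thesis by (simp add: algebra_simps)
    qed
    then show ?thesis by blast
  qed
  show ?thesis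
  proof (induction e)
    case (Const i)
    have "etime (Const i) (\<lambda>_. d) \<le> dsize (Atom i) * dsize d" for d
      using dsize_ge1[of d] mult_le_mono2[of 1 "dsize d" "dsize (Atom i)"] by simp
    then show ?case by blast
  next
    case (Var x)
    have "etime (Var x) (\<lambda>_. d) \<le> 1 * dsize d" for d by simp
    then show ?case by blast
  next
    case (MkNode e f)
    show ?case
    proof (rule step[OF MkNode.IH])
      fix d
      show "etime (MkNode e f) (\<lambda>_. d) \<le> 2 * etime e (\<lambda>_. d) + 2 * etime f (\<lambda>_. d) + 2"
        using dsize_eval_le_etime[of e "\<lambda>_. d"] dsize_eval_le_etime[of f "\<lambda>_. d"] by simp
    qed
  next
    case (Fst e)
    show ?case
    proof (rule step[OF Fst.IH Fst.IH])
      fix d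
      show "etime (Fst e) (\<lambda>_. d) \<le> 2 * etime e (\<lambda>_. d) + 2 * etime e (\<lambda>_. d) + 2"
        using dsize_eval_le_etime[of e "\<lambda>_. d"] dsize_dfst[of "eval e (\<lambda>_. d)"] by simp
    qed
  next
    case (Snd e)
    show ?case
    proof (rule step[OF Snd.IH Snd.IH])
      fix d
      show "etime (Snd e) (\<lambda>_. d) \<le> 2 * etime e (\<lambda>_. d) + 2 * etime e (\<lambda>_. d) + 2"
        using dsize_eval_le_etime[of e "\<lambda>_. d"] dsize_dsnd[of "eval e (\<lambda>_. d)"] by simp
    qed
  next
    case (IsNode e)
    show ?case
    proof (rule step[OF IsNode.IH IsNode.IH])
      fix d
      show "etime (IsNode e) (\<lambda>_. d) \<le> 2 * etime e (\<lambda>_. d) + 2 * etime e (\<lambda>_. d) + 2"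
        using dsize_of_bool[of "is_node (eval e (\<lambda>_. d))"] by (simp del: dsize.simps)
    qed
  next
    case (Eq e f)
    show ?case
    proof (rule step[OF Eq.IH])
      fix d
      show "etime (Eq e f) (\<lambda>_. d) \<le> 2 * etime e (\<lambda>_. d) + 2 * etime f (\<lambda>_. d) + 2"
        using dsize_of_bool[of "eval e (\<lambda>_. d) = eval f (\<lambda>_. d)"] by (simp del: dsize.simps)
    qed
  next
    case (Less e f)
    show ?case
    proof (rule step[OF Less.IH])
      fix d
      show "etime (Less e f) (\<lambda>_. d) \<le> 2 * etime e (\<lambda>_. d) + 2 * etime f (\<lambda>_. d) + 2"
        using dsize_of_bool[of "dint (eval e (\<lambda>_. d)) < dint (eval f (\<lambda>_. d))"]
        by (simp del: dsize.simps)
    qed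
  next
    case (Add e f)
    show ?case
    proof (rule step[OF Add.IH])
      fix d
      show "etime (Add e f) (\<lambda>_. d) \<le> 2 * etime e (\<lambda>_. d) + 2 * etime f (\<lambda>_. d) + 2"
        using dsize_eval_le_etime[of e "\<lambda>_. d"] dsize_eval_le_etime[of f "\<lambda>_. d"]
          dsize_dint[of "eval e (\<lambda>_. d)"] dsize_dint[of "eval f (\<lambda>_. d)"]
          dsize_add[of "dint (eval e (\<lambda>_. d))" "dint (eval f (\<lambda>_. d))"]
        by (simp del: dsize.simps)
    qed
  next
    case (Sub e f)
    show ?case
    proof (rule step[OF Sub.IH])
      fix d
      show "etime (Sub e f) (\<lambda>_. d) \<le> 2 * etime e (\<lambda>_. d) + 2 * etime f (\<lambda>_. d) + 2"
        using dsize_eval_le_etime[of e "\<lambda>_. d"] dsize_eval_le_etime[of f "\<lambda>_. d"]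
          dsize_dint[of "eval e (\<lambda>_. d)"] dsize_dint[of "eval f (\<lambda>_. d)"]
          dsize_diff[of "dint (eval e (\<lambda>_. d))" "dint (eval f (\<lambda>_. d))"]
        by (simp del: dsize.simps)
    qed
  next
    case (Mul e f)
    show ?case
    proof (rule step[OF Mul.IH])
      fix d
      show "etime (Mul e f) (\<lambda>_. d) \<le> 2 * etime e (\<lambda>_. d) + 2 * etime f (\<lambda>_. d) + 2"
        using dsize_eval_le_etime[of e "\<lambda>_. d"] dsize_eval_le_etime[of f "\<lambda>_. d"]
          dsize_dint[of "eval e (\<lambda>_. d)"] dsize_dint[of "eval f (\<lambda>_. d)"]
          dsize_mult[of "dint (eval e (\<lambda>_. d))" "dint (eval f (\<lambda>_. d))"]
        by (simp del: dsize.simps)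
    qed
  next
    case (Div e f)
    show ?case
    proof (rule step[OF Div.IH])
      fix d
      show "etime (Div e f) (\<lambda>_. d) \<le> 2 * etime e (\<lambda>_. d) + 2 * etime f (\<lambda>_. d) + 2"
        using dsize_eval_le_etime[of e "\<lambda>_. d"] dsize_eval_le_etime[of f "\<lambda>_. d"]
          dsize_dint[of "eval e (\<lambda>_. d)"]
          dsize_div[of "dint (eval e (\<lambda>_. d))" "dint (eval f (\<lambda>_. d))"]
        by (simp del: dsize.simps)
    qed
  qed
qed

section \<open>Variables of a program and independence of the rest of the store\<close>

fun exp_vars :: "exp \<Rightarrow> nat set" where
  "exp_vars (Const i) = {}"
| "exp_vars (Var x) = {x}"
| "exp_vars (MkNode e f) = exp_vars e \<union> exp_vars f"
| "exp_vars (Fst e) = exp_vars e"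
| "exp_vars (Snd e) = exp_vars e"
| "exp_vars (IsNode e) = exp_vars e"
| "exp_vars (Eq e f) = exp_vars e \<union> exp_vars f"
| "exp_vars (Less e f) = exp_vars e \<union> exp_vars f"
| "exp_vars (Add e f) = exp_vars e \<union> exp_vars f"
| "exp_vars (Sub e f) = exp_vars e \<union> exp_vars f"
| "exp_vars (Mul e f) = exp_vars e \<union> exp_vars f"
| "exp_vars (Div e f) = exp_vars e \<union> exp_vars f"

fun com_vars :: "com \<Rightarrow> nat set" where
  "com_vars Skip = {}"
| "com_vars (Assign x e) = insert x (exp_vars e)"
| "com_vars (Seq c d) = com_vars c \<union> com_vars d"
| "com_vars (Cond e c d) = exp_vars e \<union> com_vars c \<union> com_vars d"
| "com_vars (While e c) = exp_vars e \<union> com_vars c"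

lemma finite_exp_vars: "finite (exp_vars e)"
  by (induction e) auto

lemma finite_com_vars: "finite (com_vars c)"
  by (induction c) (auto simp: finite_exp_vars)

lemma eval_cong: "(\<And>i. i \<in> exp_vars e \<Longrightarrow> s i = r i) \<Longrightarrow> eval e s = eval e r"
  by (induction e) auto

lemma etime_cong: "(\<And>i. i \<in> exp_vars e \<Longrightarrow> s i = r i) \<Longrightarrow> etime e s = etime e r"
  by (induction e) (auto cong: eval_cong simp del: dsize.simps)

text \<open>\<open>computes\<close> speaks of a store that is \<open>Atom 0\<close> outside variable
  \<open>0\<close>, but a subroutine runs while other variables hold data. Only the variables
  occurring in the program matter, also for the time.\<close>

lemma exec_frame:
  assumes "exec c s t s'" and "com_vars c \<subseteq> X" and "\<And>i. i \<in> X \<Longrightarrow> r i = s i"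
  shows "\<exists>r'. exec c r t r' \<and> (\<forall>i\<in>X. r' i = s' i) \<and> (\<forall>i. i \<notin> X \<longrightarrow> r' i = r i)"
  using assms
proof (induction arbitrary: r rule: exec.induct)
  case (Skip s)
  then show ?case using exec.Skip[of r] by (intro exI[of _ r]) auto
next
  case (Assign x e s)
  have v: "eval e r = eval e s" and t: "etime e r = etime e s"
    using Assign.prems by (auto intro!: eval_cong etime_cong)
  have ex: "exec (Assign x e) r (1 + etime e s) (r(x := eval e s))"
    using exec.Assign[of x e r] by (simp only: v t)
  show ?case
    by (rule exI[of _ "r(x := eval e s)"], intro conjI, rule ex) (use Assign.prems in auto)
next
  case (Seq c s t s1 d u s2)
  from Seq.IH(1)[of r] Seq.prems obtain r1 where r1: "exec c r t r1" "\<forall>i\<in>X. r1 i = s1 i"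
    "\<forall>i. i \<notin> X \<longrightarrow> r1 i = r i" by auto
  from Seq.IH(2)[of r1] Seq.prems r1(2) obtain r2 where "exec d r1 u r2" "\<forall>i\<in>X. r2 i = s2 i"
    "\<forall>i. i \<notin> X \<longrightarrow> r2 i = r1 i" by auto
  with r1 show ?case by (auto intro!: exI[of _ r2] exec.Seq)
next
  case (CondTrue e s c t s1 d)
  have v: "eval e r = eval e s" and t: "etime e r = etime e s"
    using CondTrue.prems by (auto intro!: eval_cong etime_cong)
  from CondTrue.IH[of r] CondTrue.prems obtain r1 where "exec c r t r1" "\<forall>i\<in>X. r1 i = s1 i"
    "\<forall>i. i \<notin> X \<longrightarrow> r1 i = r i" by auto
  with CondTrue.hyps(1) exec.CondTrue[of e r c t r1 d] show ?case
    by (auto simp: v t)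
next
  case (CondFalse e s d t s1 c)
  have v: "eval e r = eval e s" and t: "etime e r = etime e s"
    using CondFalse.prems by (auto intro!: eval_cong etime_cong)
  from CondFalse.IH[of r] CondFalse.prems obtain r1 where "exec d r t r1" "\<forall>i\<in>X. r1 i = s1 i"
    "\<forall>i. i \<notin> X \<longrightarrow> r1 i = r i" by auto
  with CondFalse.hyps(1) exec.CondFalse[of e r d t r1 c] show ?case
    by (auto simp: v t)
next
  case (WhileFalse e s c)
  have v: "eval e r = eval e s" and t: "etime e r = etime e s"
    using WhileFalse.prems by (auto intro!: eval_cong etime_cong)
  with WhileFalse exec.WhileFalse[of e r c] show ?case by (auto intro!: exI[of _ r])
next
  case (WhileTrue e s c t s1 u s2)
  have v: "eval e r = eval e s" and t: "etime e r = etime e s"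
    using WhileTrue.prems by (auto intro!: eval_cong etime_cong)
  from WhileTrue.IH(1)[of r] WhileTrue.prems obtain r1 where r1: "exec c r t r1" "\<forall>i\<in>X. r1 i = s1 i"
    "\<forall>i. i \<notin> X \<longrightarrow> r1 i = r i" by auto
  from WhileTrue.IH(2)[of r1] WhileTrue.prems r1(2)
  obtain r2 where r2: "exec (While e c) r1 u r2" "\<forall>i\<in>X. r2 i = s2 i"
    "\<forall>i. i \<notin> X \<longrightarrow> r2 i = r1 i" by auto
  have "exec (While e c) r (1 + etime e r + t + u) r2"
    using WhileTrue.hyps(1) r1(1) r2(1) by (intro exec.WhileTrue) (auto simp: v)
  with r1 r2 show ?case by (auto intro!: exI[of _ r2] simp: t)
qed

text \<open>Writing a value costs at least its size, so polynomial time implies polynomial output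
  size.\<close>

lemma exec_dsize: "exec c s t s' \<Longrightarrow> dsize (s' i) \<le> dsize (s i) + t"
proof (induction rule: exec.induct)
  case (Assign x e s)
  then show ?case using dsize_eval_le_etime[of e s] by auto
qed auto

lemma poly_nat_mono: "m \<le> n \<Longrightarrow> poly p m \<le> poly (p :: nat poly) n"
  by (induction p) (auto intro: mult_mono)

section \<open>Polynomial-time functions\<close>

text \<open>A program runs tidily if it only changes variable \<open>0\<close>, provided that its work variables
  hold \<open>Atom 0\<close> at the start; tidy programs can be composed without
  renaming variables.\<close>

definition runs_tidily :: "com \<Rightarrow> nat \<Rightarrow> nat poly \<Rightarrow> data set \<Rightarrow> (data \<Rightarrow> data) \<Rightarrow> bool" where
  "runs_tidily c N p D f \<longleftrightarrow> 0 < N \<and>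
    (\<forall>s. s 0 \<in> D \<longrightarrow> (\<forall>i. 0 < i \<and> i < N \<longrightarrow> s i = Atom 0) \<longrightarrow>
      (\<exists>t \<le> poly p (dsize (s 0)). exec c s t (s(0 := f (s 0)))))"

text \<open>\<open>D\<close> is a promise on the inputs. It cannot be dropped, since nothing is
  known about the min-sum program on invalid inputs.\<close>

definition ptime :: "data set \<Rightarrow> (data \<Rightarrow> data) \<Rightarrow> bool" where
  "ptime D f \<longleftrightarrow> (\<exists>c N p. runs_tidily c N p D f)"

lemma runs_tidilyD:
  assumes "runs_tidily c N p D f" and "s 0 = x" and "x \<in> D"
    and "\<And>i. 0 < i \<Longrightarrow> i < N \<Longrightarrow> s i = Atom 0"
  shows "\<exists>t. t \<le> poly p (dsize x) \<and> exec c s t (s(0 := f x))"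
  using assms unfolding runs_tidily_def by blast

lemma ptime_computes:
  assumes "ptime D f"
  shows "\<exists>c p. \<forall>x\<in>D. \<exists>t. computes c x t (f x) \<and> t \<le> poly p (dsize x)"
proof -
  from assms obtain c N p where c: "runs_tidily c N p D f" unfolding ptime_def by blast
  have "\<exists>t. computes c x t (f x) \<and> t \<le> poly p (dsize x)" if "x \<in> D" for x
    using runs_tidilyD[OF c, of "(\<lambda>_. Atom 0)(0 := x)" x] that unfolding computes_def by fastforce
  then show ?thesis by blast
qed

lemma ptime_dsize:
  assumes "ptime D f"
  shows "\<exists>p. \<forall>x\<in>D. dsize (f x) \<le> poly p (dsize x)"
proof -
  from ptime_computes[OF assms] obtain c p
    where c: "\<And>x. x \<in> D \<Longrightarrow> \<exists>t. computes c x t (f x) \<and> t \<le> poly p (dsize x)" by blast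
  have "dsize (f x) \<le> poly ([:0, 1:] + p) (dsize x)" if x: "x \<in> D" for x
  proof -
    from c[OF x] obtain t s where "exec c ((\<lambda>_. Atom 0)(0 := x)) t s" "s 0 = f x" "t \<le> poly p (dsize x)"
      unfolding computes_def by blast
    with exec_dsize[of c "(\<lambda>_. Atom 0)(0 := x)" t s 0] show ?thesis by simp
  qed
  then show ?thesis by blast
qed

fun clear :: "nat \<Rightarrow> com" where
  "clear 0 = Skip"
| "clear (Suc n) = Seq (clear n) (Assign (Suc n) (Const 0))"

lemma exec_clear: "exec (clear n) s (1 + 2 * n) (\<lambda>i. if 0 < i \<and> i \<le> n then Atom 0 else s i)"
proof (induction n)
  case 0
  have "(\<lambda>i. if 0 < i \<and> i \<le> 0 then Atom 0 else s i) = s" by auto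
  then show ?case using exec.Skip[of s] by (simp only: clear.simps mult_0_right add_0_right)
next
  case (Suc n)
  let ?s = "\<lambda>i. if 0 < i \<and> i \<le> n then Atom 0 else s i"
  have eq: "?s(Suc n := Atom 0) = (\<lambda>i. if 0 < i \<and> i \<le> Suc n then Atom 0 else s i)" by auto
  have "exec (Assign (Suc n) (Const 0)) ?s 2 (?s(Suc n := Atom 0))"
    using exec.Assign[of "Suc n" "Const 0" ?s] by (simp add: floorlog_def numeral_2_eq_2)
  from exec.Seq[OF Suc.IH this] show ?case unfolding eq by simp
qed

text \<open>A program mentions finitely many variables, so all of them can be reset afterwards at
  constant cost. This is how the given min-sum program becomes a subroutine.\<close>

lemma ptime_of_computes:
  assumes c: "\<And>x. x \<in> D \<Longrightarrow> \<exists>t. computes c x t (f x) \<and> t \<le> poly p (dsize x)"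
  shows "ptime D f"
proof -
  obtain n where n: "com_vars c \<subseteq> {..n}"
    using finite_com_vars[of c] by (metis finite_nat_iff_bounded_le)
  have "runs_tidily (Seq c (clear n)) (Suc n) (p + [:1 + 2 * n:]) D f"
    unfolding runs_tidily_def
  proof (intro conjI allI impI)
    fix s :: store
    assume s0: "s 0 \<in> D" and clean: "\<forall>i. 0 < i \<and> i < Suc n \<longrightarrow> s i = Atom 0"
    from c[OF s0] obtain t s' where t: "exec c ((\<lambda>_. Atom 0)(0 := s 0)) t s'" "s' 0 = f (s 0)"
      "t \<le> poly p (dsize (s 0))" unfolding computes_def by blast
    have "s i = ((\<lambda>_. Atom 0)(0 := s 0)) i" if "i \<in> {..n}" for i using clean that by auto
    from exec_frame[OF t(1) n this] obtain r where r: "exec c s t r" "\<forall>i\<in>{..n}. r i = s' i"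
      "\<forall>i. i \<notin> {..n} \<longrightarrow> r i = s i" by blast
    have "(\<lambda>i. if 0 < i \<and> i \<le> n then Atom 0 else r i) = s(0 := f (s 0))"
      using r(2,3) t(2) clean by (auto simp: fun_eq_iff)
    with exec.Seq[OF r(1) exec_clear[of n r]] have "exec (Seq c (clear n)) s (t + (1 + 2 * n)) (s(0 := f (s 0)))"
      by simp
    then show "\<exists>t\<le>poly (p + [:1 + 2 * n:]) (dsize (s 0)). exec (Seq c (clear n)) s t (s(0 := f (s 0)))"
      using t(3) by (intro exI[of _ "t + (1 + 2 * n)"]) simp
  qed simp
  then show ?thesis unfolding ptime_def by blast
qed

lemma computes_deterministic: "computes c x t y \<Longrightarrow> computes c x u z \<Longrightarrow> y = z"
  unfolding computes_def using exec_deterministic by blast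

lemma ptime_cong:
  assumes "ptime D f" and "\<And>x. x \<in> D \<Longrightarrow> f x = g x"
  shows "ptime D g"
proof -
  from assms(1) obtain c N p where "runs_tidily c N p D f" unfolding ptime_def by blast
  then have "runs_tidily c N p D g" using assms(2) unfolding runs_tidily_def by simp
  then show ?thesis unfolding ptime_def by blast
qed

lemma ptime_comp:
  assumes "ptime E g" and "ptime D f" and "\<And>x. x \<in> D \<Longrightarrow> f x \<in> E"
  shows "ptime D (\<lambda>x. g (f x))"
proof -
  from assms obtain c N p d M q where c: "runs_tidily c N p D f" and d: "runs_tidily d M q E g"
    unfolding ptime_def by blast
  \<comment> \<open>The second program receives a value whose size is at most that of the input plus
    the time of the first program.\<close>
  let ?r = "p + pcompose q ([:0, 1:] + p)"
  have "runs_tidily (Seq c d) (max N M) ?r D (\<lambda>x. g (f x))"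
    unfolding runs_tidily_def
  proof (intro conjI allI impI)
    show "0 < max N M" using c unfolding runs_tidily_def by (simp add: less_max_iff_disj)
    fix s :: store
    assume s0: "s 0 \<in> D" and clean: "\<forall>i. 0 < i \<and> i < max N M \<longrightarrow> s i = Atom 0"
    have "\<exists>t. t \<le> poly p (dsize (s 0)) \<and> exec c s t (s(0 := f (s 0)))"
      by (rule runs_tidilyD[OF c]) (use clean s0 in auto)
    then obtain t where t: "t \<le> poly p (dsize (s 0))" "exec c s t (s(0 := f (s 0)))" by blast
    have "\<exists>u. u \<le> poly q (dsize (f (s 0))) \<and> exec d (s(0 := f (s 0))) u (s(0 := f (s 0), 0 := g (f (s 0))))"
      by (rule runs_tidilyD[OF d]) (use clean assms(3)[OF s0] in auto)
    then obtain u where u: "u \<le> poly q (dsize (f (s 0)))"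
      "exec d (s(0 := f (s 0))) u (s(0 := g (f (s 0))))" unfolding fun_upd_upd by blast
    have "dsize (f (s 0)) \<le> dsize (s 0) + poly p (dsize (s 0))"
      using exec_dsize[OF t(2), of 0] t(1) by simp
    then have "poly q (dsize (f (s 0))) \<le> poly q (dsize (s 0) + poly p (dsize (s 0)))"
      by (rule poly_nat_mono)
    then have "t + u \<le> poly ?r (dsize (s 0))" using t(1) u(1) by (simp add: poly_pcompose)
    then show "\<exists>t\<le>poly ?r (dsize (s 0)). exec (Seq c d) s t (s(0 := g (f (s 0))))"
      using exec.Seq[OF t(2) u(2)] by blast
  qed
  then show ?thesis unfolding ptime_def by blast
qed

lemma ptime_exp:
  assumes "exp_vars e \<subseteq> {0}"
  shows "ptime D (\<lambda>d. eval e (\<lambda>_. d))"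
proof -
  obtain C where C: "\<And>d. etime e (\<lambda>_. d) \<le> C * dsize d" using etime_linear by blast
  have "runs_tidily (Assign 0 e) 1 [:1, C:] D (\<lambda>d. eval e (\<lambda>_. d))"
    unfolding runs_tidily_def
  proof (intro conjI allI impI)
    fix s :: store
    have v: "eval e s = eval e (\<lambda>_. s 0)" and t: "etime e s = etime e (\<lambda>_. s 0)"
      using assms by (auto intro!: eval_cong etime_cong)
    show "\<exists>t\<le>poly [:1, C:] (dsize (s 0)). exec (Assign 0 e) s t (s(0 := eval e (\<lambda>_. s 0)))"
      using exec.Assign[of 0 e s] C[of "s 0"] by (auto simp: v t algebra_simps)
  qed simp
  then show ?thesis unfolding ptime_def by blast
qed

lemma ptime_id: "ptime D (\<lambda>x. x)"
  using ptime_exp[of "Var 0"] by simp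

lemma exec_AssignI: "eval e s = v \<Longrightarrow> exec (Assign x e) s (1 + etime e s) (s(x := v))"
  using exec.Assign by blast

text \<open>Both programs expect their input in variable \<open>0\<close> and leave their output
  there. Variables \<open>M\<close> and \<open>M + 1\<close>, beyond all work variables, keep the
  input and the first result meanwhile and are reset at the end.\<close>

lemma ptime_pair:
  assumes "ptime D f" and "ptime D g"
  shows "ptime D (\<lambda>x. Node (f x) (g x))"
proof -
  from assms obtain c N p d N' q where c: "runs_tidily c N p D f" and d: "runs_tidily d N' q D g"
    unfolding ptime_def by blast
  define M where "M = max N N'"
  have M: "0 < M" "N \<le> M" "N' \<le> M" using c unfolding M_def runs_tidily_def by auto
  define prog where "prog = Seq (Assign M (Var 0)) (Seq c (Seq (Assign (M + 1) (Var 0))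
    (Seq (Assign 0 (Var M)) (Seq d (Seq (Assign 0 (MkNode (Var (M + 1)) (Var 0)))
    (Seq (Assign M (Const 0)) (Assign (M + 1) (Const 0))))))))"
  define r where "r = [:20, 10:] + 10 * p + 10 * q"
  have "runs_tidily prog (M + 2) r D (\<lambda>x. Node (f x) (g x))"
    unfolding runs_tidily_def
  proof (intro conjI allI impI)
    fix s :: store
    assume s0: "s 0 \<in> D" and clean: "\<forall>i. 0 < i \<and> i < M + 2 \<longrightarrow> s i = Atom 0"
    let ?x = "s 0" and ?y = "f (s 0)" and ?z = "g (s 0)"
    have "\<exists>t. t \<le> poly p (dsize ?x) \<and> exec c (s(M := ?x)) t (s(M := ?x, 0 := ?y))"
      by (rule runs_tidilyD[OF c]) (use s0 clean M in auto)
    then obtain t where t: "t \<le> poly p (dsize ?x)" "exec c (s(M := ?x)) t (s(M := ?x, 0 := ?y))"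
      by blast
    let ?s = "s(M := ?x, 0 := ?y, M + 1 := ?y, 0 := ?x)"
    have "\<exists>u. u \<le> poly q (dsize ?x) \<and> exec d ?s u (?s(0 := ?z))"
      by (rule runs_tidilyD[OF d]) (use s0 clean M in auto)
    then obtain u where u: "u \<le> poly q (dsize ?x)" "exec d ?s u (?s(0 := ?z))" by blast
    have y: "dsize ?y \<le> dsize ?x + poly p (dsize ?x)" using exec_dsize[OF t(2), of 0] t(1) M by simp
    have z: "dsize ?z \<le> dsize ?x + poly q (dsize ?x)" using exec_dsize[OF u(2), of 0] u(1) M by simp
    let ?t8 = "1 + etime (Const 0) (?s(0 := Node ?y ?z, M := Atom 0))"
    let ?t7 = "1 + etime (Const 0) (?s(0 := Node ?y ?z))"
    let ?t6 = "1 + etime (MkNode (Var (M + 1)) (Var 0)) (?s(0 := ?z))"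
    let ?t4 = "1 + etime (Var M) (s(M := ?x, 0 := ?y, M + 1 := ?y))"
    let ?t3 = "1 + etime (Var 0) (s(M := ?x, 0 := ?y))"
    let ?t1 = "1 + etime (Var 0) s"
    have x8: "exec (Assign (M + 1) (Const 0)) (?s(0 := Node ?y ?z, M := Atom 0)) ?t8
      (?s(0 := Node ?y ?z, M := Atom 0, M + 1 := Atom 0))"
      by (rule exec_AssignI) (use M in simp)
    have x7: "exec (Assign M (Const 0)) (?s(0 := Node ?y ?z)) ?t7 (?s(0 := Node ?y ?z, M := Atom 0))"
      by (rule exec_AssignI) (use M in simp)
    have x6: "exec (Assign 0 (MkNode (Var (M + 1)) (Var 0))) (?s(0 := ?z)) ?t6 (?s(0 := Node ?y ?z))"
      by (subst fun_upd_upd[of ?s 0 ?z "Node ?y ?z", symmetric], rule exec_AssignI) (use M in simp)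
    have x4: "exec (Assign 0 (Var M)) (s(M := ?x, 0 := ?y, M + 1 := ?y)) ?t4 ?s"
      by (rule exec_AssignI) (use M in simp)
    have x3: "exec (Assign (M + 1) (Var 0)) (s(M := ?x, 0 := ?y)) ?t3 (s(M := ?x, 0 := ?y, M + 1 := ?y))"
      by (rule exec_AssignI) (use M in simp)
    have x1: "exec (Assign M (Var 0)) s ?t1 (s(M := ?x))"
      by (rule exec_AssignI) (use M in simp)
    have final: "?s(0 := Node ?y ?z, M := Atom 0, M + 1 := Atom 0) = s(0 := Node ?y ?z)"
      using clean M by (auto simp: fun_eq_iff)
    let ?t = "?t1 + (t + (?t3 + (?t4 + (u + (?t6 + (?t7 + ?t8))))))"
    have ex: "exec prog s ?t (s(0 := Node ?y ?z))"
      using exec.Seq[OF x1 exec.Seq[OF t(2) exec.Seq[OF x3 exec.Seq[OF x4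
        exec.Seq[OF u(2) exec.Seq[OF x6 exec.Seq[OF x7 x8]]]]]]]
      unfolding prog_def final .
    have "dsize (Atom 0) = 1" by (simp add: floorlog_def)
    then have "?t \<le> poly r (dsize ?x)"
      using t(1) u(1) y z M by (simp add: r_def del: dsize.simps(1))
    with ex show "\<exists>t\<le>poly r (dsize ?x). exec prog s t (s(0 := Node ?y ?z))" by blast
  qed simp
  then show ?thesis unfolding ptime_def by blast
qed

text \<open>The test of \<open>Cond\<close> is an expression, while \<open>P\<close> may need a
  whole program. Hence the truth value is first paired with \<open>x\<close>, and the conditional
  only inspects this pair.\<close>

lemma ptime_if:
  assumes P: "ptime D (\<lambda>x. Atom (of_bool (P x)))" and "ptime D f" and "ptime D g"
  shows "ptime D (\<lambda>x. if P x then f x else g x)"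
proof -
  from assms obtain c N p d M q where c: "runs_tidily c N p D f" and d: "runs_tidily d M q D g"
    unfolding ptime_def by blast
  define prog where
    "prog = Cond (Fst (Var 0)) (Seq (Assign 0 (Snd (Var 0))) c) (Seq (Assign 0 (Snd (Var 0))) d)"
  define r where "r = [:2, 10:] + p + q"
  have "runs_tidily prog (max N M) r {z. dsnd z \<in> D}
    (\<lambda>z. if dfst z \<noteq> Atom 0 then f (dsnd z) else g (dsnd z))"
    unfolding runs_tidily_def
  proof (intro conjI allI impI)
    show "0 < max N M" using c unfolding runs_tidily_def by (simp add: less_max_iff_disj)
    fix s :: store
    assume s0: "s 0 \<in> {z. dsnd z \<in> D}" and clean: "\<forall>i. 0 < i \<and> i < max N M \<longrightarrow> s i = Atom 0"
    let ?x = "dsnd (s 0)" and ?h = "if dfst (s 0) \<noteq> Atom 0 then f (dsnd (s 0)) else g (dsnd (s 0))"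
    let ?t1 = "1 + etime (Fst (Var 0)) s" and ?t2 = "1 + etime (Snd (Var 0)) s"
    have x2: "exec (Assign 0 (Snd (Var 0))) s ?t2 (s(0 := ?x))"
      by (rule exec_AssignI) simp
    have le: "poly p (dsize ?x) \<le> poly p (dsize (s 0))" "poly q (dsize ?x) \<le> poly q (dsize (s 0))"
      using dsize_dsnd[of "s 0"] by (auto intro: poly_nat_mono)
    show "\<exists>t\<le>poly r (dsize (s 0)). exec prog s t (s(0 := ?h))"
    proof (cases "dfst (s 0) = Atom 0")
      case False
      have "\<exists>t. t \<le> poly p (dsize ?x) \<and> exec c (s(0 := ?x)) t (s(0 := ?x, 0 := f ?x))"
        by (rule runs_tidilyD[OF c]) (use s0 clean in auto)
      then obtain t where t: "t \<le> poly p (dsize ?x)" "exec c (s(0 := ?x)) t (s(0 := f ?x))"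
        unfolding fun_upd_upd by blast
      have "exec prog s (?t1 + (?t2 + t)) (s(0 := f ?x))"
        unfolding prog_def using False by (intro exec.CondTrue exec.Seq[OF x2 t(2)]) simp
      moreover have "?t1 + (?t2 + t) \<le> poly r (dsize (s 0))"
        using t(1) le dsize_dsnd[of "s 0"] dsize_dfst[of "s 0"] by (simp add: r_def)
      ultimately show ?thesis using False by auto
    next
      case True
      have "\<exists>t. t \<le> poly q (dsize ?x) \<and> exec d (s(0 := ?x)) t (s(0 := ?x, 0 := g ?x))"
        by (rule runs_tidilyD[OF d]) (use s0 clean in auto)
      then obtain t where t: "t \<le> poly q (dsize ?x)" "exec d (s(0 := ?x)) t (s(0 := g ?x))"
        unfolding fun_upd_upd by blast
      have "exec prog s (?t1 + (?t2 + t)) (s(0 := g ?x))"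
        unfolding prog_def using True by (intro exec.CondFalse exec.Seq[OF x2 t(2)]) simp
      moreover have "?t1 + (?t2 + t) \<le> poly r (dsize (s 0))"
        using t(1) le dsize_dsnd[of "s 0"] dsize_dfst[of "s 0"] by (simp add: r_def)
      ultimately show ?thesis using True by auto
    qed
  qed
  then have "ptime {z. dsnd z \<in> D} (\<lambda>z. if dfst z \<noteq> Atom 0 then f (dsnd z) else g (dsnd z))"
    unfolding ptime_def by blast
  from ptime_comp[OF this ptime_pair[OF P ptime_id]] show ?thesis
    by (rule ptime_cong) auto
qed

section \<open>Closure under the basic operations of the language\<close>

lemma ptime_unary:
  assumes "exp_vars e \<subseteq> {0}" and "\<And>d. eval e (\<lambda>_. d) = g d" and "ptime D f"
  shows "ptime D (\<lambda>x. g (f x))"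
  using ptime_comp[OF ptime_exp[OF assms(1), of UNIV] assms(3)] assms(2) by simp

lemma ptime_fst: "ptime D f \<Longrightarrow> ptime D (\<lambda>x. dfst (f x))"
  by (rule ptime_unary[of "Fst (Var 0)" dfst D f]) simp_all

lemma ptime_snd: "ptime D f \<Longrightarrow> ptime D (\<lambda>x. dsnd (f x))"
  by (rule ptime_unary[of "Snd (Var 0)" dsnd D f]) simp_all

lemma ptime_dint: "ptime D f \<Longrightarrow> ptime D (\<lambda>x. Atom (dint (f x)))"
  by (rule ptime_unary[of "Add (Var 0) (Const 0)" "\<lambda>d. Atom (dint d)" D f]) simp_all

lemma ptime_is_node: "ptime D f \<Longrightarrow> ptime D (\<lambda>x. Atom (of_bool (is_node (f x))))"
  by (rule ptime_unary[of "IsNode (Var 0)" "\<lambda>d. Atom (of_bool (is_node d))" D f]) simp_all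

lemma ptime_not: "ptime D (\<lambda>x. Atom (of_bool (P x))) \<Longrightarrow> ptime D (\<lambda>x. Atom (of_bool (\<not> P x)))"
  using ptime_unary[of "Sub (Const 1) (Var 0)" "\<lambda>d. Atom (1 - dint d)" D "\<lambda>x. Atom (of_bool (P x))"]
  by (simp add: of_bool_not_iff)

lemma ptime_binary:
  assumes "ptime D f" and "ptime D g"
    and "exp_vars e \<subseteq> {0}" and "\<And>a b. eval e (\<lambda>_. Node a b) = h a b"
  shows "ptime D (\<lambda>x. h (f x) (g x))"
  using ptime_comp[OF ptime_exp[OF assms(3), of UNIV] ptime_pair[OF assms(1,2)]] assms(4) by simp

lemma ptime_eq:
  assumes "ptime D f" and "ptime D g"
  shows "ptime D (\<lambda>x. Atom (of_bool (f x = g x)))"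
  by (rule ptime_binary[OF assms, of "Eq (Fst (Var 0)) (Snd (Var 0))" "\<lambda>a b. Atom (of_bool (a = b))"]) simp_all

lemma ptime_less:
  assumes "ptime D (\<lambda>x. Atom (f x))" and "ptime D (\<lambda>x. Atom (g x))"
  shows "ptime D (\<lambda>x. Atom (of_bool (f x < g x)))"
  using ptime_binary[OF assms, of "Less (Fst (Var 0)) (Snd (Var 0))" "\<lambda>a b. Atom (of_bool (dint a < dint b))"]
  by simp

lemma ptime_le:
  assumes "ptime D (\<lambda>x. Atom (f x))" and "ptime D (\<lambda>x. Atom (g x))"
  shows "ptime D (\<lambda>x. Atom (of_bool (f x \<le> g x)))"
  using ptime_not[OF ptime_less[OF assms(2,1)]] by (simp add: not_less)

lemma ptime_conj:
  assumes "ptime D (\<lambda>x. Atom (of_bool (P x)))" and "ptime D (\<lambda>x. Atom (of_bool (Q x)))"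
  shows "ptime D (\<lambda>x. Atom (of_bool (P x \<and> Q x)))"
  using ptime_binary[OF assms, of "Mul (Fst (Var 0)) (Snd (Var 0))" "\<lambda>a b. Atom (dint a * dint b)"]
  by (simp add: of_bool_conj)

lemma ptime_disj:
  assumes "ptime D (\<lambda>x. Atom (of_bool (P x)))" and "ptime D (\<lambda>x. Atom (of_bool (Q x)))"
  shows "ptime D (\<lambda>x. Atom (of_bool (P x \<or> Q x)))"
  using ptime_not[OF ptime_conj[OF ptime_not[OF assms(1)] ptime_not[OF assms(2)]]] by simp

lemma ptime_add:
  assumes "ptime D (\<lambda>x. Atom (f x))" and "ptime D (\<lambda>x. Atom (g x))"
  shows "ptime D (\<lambda>x. Atom (f x + g x))"
  using ptime_binary[OF assms, of "Add (Fst (Var 0)) (Snd (Var 0))" "\<lambda>a b. Atom (dint a + dint b)"]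
  by simp

lemma ptime_diff:
  assumes "ptime D (\<lambda>x. Atom (f x))" and "ptime D (\<lambda>x. Atom (g x))"
  shows "ptime D (\<lambda>x. Atom (f x - g x))"
  using ptime_binary[OF assms, of "Sub (Fst (Var 0)) (Snd (Var 0))" "\<lambda>a b. Atom (dint a - dint b)"]
  by simp

lemma ptime_mult:
  assumes "ptime D (\<lambda>x. Atom (f x))" and "ptime D (\<lambda>x. Atom (g x))"
  shows "ptime D (\<lambda>x. Atom (f x * g x))"
  using ptime_binary[OF assms, of "Mul (Fst (Var 0)) (Snd (Var 0))" "\<lambda>a b. Atom (dint a * dint b)"]
  by simp

lemma ptime_div:
  assumes "ptime D (\<lambda>x. Atom (f x))" and "ptime D (\<lambda>x. Atom (g x))"
  shows "ptime D (\<lambda>x. Atom (f x div g x))"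
  using ptime_binary[OF assms, of "Div (Fst (Var 0)) (Snd (Var 0))" "\<lambda>a b. Atom (dint a div dint b)"]
  by simp

lemma ptime_max:
  assumes "ptime D (\<lambda>x. Atom (f x))" and "ptime D (\<lambda>x. Atom (g x))"
  shows "ptime D (\<lambda>x. Atom (max (f x) (g x)))"
  using ptime_if[OF ptime_le[OF assms] assms(2,1)] by (simp add: max_def if_distrib)

lemma ptime_int_if:
  assumes "ptime D (\<lambda>x. Atom (of_bool (P x)))"
    and "ptime D (\<lambda>x. Atom (f x))" and "ptime D (\<lambda>x. Atom (g x))"
  shows "ptime D (\<lambda>x. Atom (if P x then f x else g x))"
  using ptime_if[OF assms] by (simp add: if_distrib)

lemma ptime_Atom_const: "ptime D (\<lambda>_. Atom i)"
  using ptime_exp[of "Const i"] by simp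

lemma ptime_const: "ptime D (\<lambda>_. d)"
proof (induction d)
  case (Atom i)
  show ?case by (rule ptime_Atom_const)
next
  case (Node a b)
  then show ?case by (rule ptime_pair)
qed

lemmas ptime_intros = ptime_Atom_const ptime_const ptime_id ptime_fst ptime_snd ptime_pair
  ptime_dint ptime_is_node ptime_not ptime_eq ptime_less ptime_le ptime_conj ptime_disj
  ptime_add ptime_diff ptime_mult ptime_div ptime_max ptime_int_if ptime_if

section \<open>Bounded recursion on lists\<close>

text \<open>The nonempty suffixes of a list. A fold over suffixes, unlike one over entries, sees the
  next entry and how many remain, as the weight differences require.\<close>

fun spine :: "data \<Rightarrow> data list" where
  "spine (Atom i) = []"
| "spine (Node a b) = Node a b # spine b"

fun items :: "data \<Rightarrow> data list" where
  "items (Atom i) = []"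
| "items (Node a b) = a # items b"

text \<open>What a traversal leaves behind: the final atom, which for arbitrary data need not be
  \<open>0\<close>.\<close>

fun stem :: "data \<Rightarrow> data" where
  "stem (Atom i) = Atom i"
| "stem (Node a b) = stem b"

lemma items_eq_map_spine: "items d = map dfst (spine d)"
  by (induction d) auto

lemma items_enc_list [simp]: "items (enc_list xs) = xs"
  by (induction xs) auto

lemma length_spine_le: "length (spine d) \<le> dsize d"
  by (induction d) auto

lemma dsize_spine_le: "y \<in> set (spine d) \<Longrightarrow> dsize y \<le> dsize d"
  by (induction d) (auto intro: le_SucI trans_le_add2)

text \<open>Variable \<open>0\<close> holds the context \<open>x\<close>, the remaining list and the
  accumulator. The cost of a round depends on the accumulator, so \<open>A\<close> has to bound it
  after every prefix; \<open>T\<close> then bounds one round of test and body.\<close>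

lemma while_spine_tidy:
  fixes h :: "data \<Rightarrow> data \<Rightarrow> data \<Rightarrow> data"
  defines "body \<equiv> \<lambda>z. Node (dfst z) (Node (dsnd (dfst (dsnd z))) (h (dfst z) (dfst (dsnd z)) (dsnd (dsnd z))))"
  assumes c: "runs_tidily c N p {z. dfst z \<in> D} body" and x: "x \<in> D"
    and T: "T = 20 + 3 * (dsize x + L + A) + poly p (2 + dsize x + L + A)"
    and "s 0 = Node x (Node d acc)" and "\<forall>i. 0 < i \<and> i < N \<longrightarrow> s i = Atom 0"
    and "\<forall>ys zs. spine d = ys @ zs \<longrightarrow> dsize (fold (h x) ys acc) \<le> A" and "dsize d \<le> L"
  shows "\<exists>t. exec (While (IsNode (Fst (Snd (Var 0)))) c) s t
      (s(0 := Node x (Node (stem d) (fold (h x) (spine d) acc)))) \<and> t \<le> (length (spine d) + 1) * T"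
  using assms(5-)
proof (induction d arbitrary: s acc)
  case (Atom i)
  have s0: "s 0 = Node x (Node (Atom i) acc)" by (fact Atom.prems(1))
  have A: "dsize acc \<le> A" using Atom.prems(3) by simp
  let ?test = "IsNode (Fst (Snd (Var 0)))"
  have z: "eval ?test s = Atom 0" using s0 by simp
  have "1 + etime ?test s \<le> T"
    using A Atom.prems(4) by (simp add: T s0 floorlog_def)
  moreover have "s(0 := Node x (Node (Atom i) acc)) = s" using s0 by (metis fun_upd_triv)
  ultimately show ?case using exec.WhileFalse[of ?test s c] z by (intro exI[of _ "1 + etime ?test s"]) simp
next
  case (Node a b)
  have s0: "s 0 = Node x (Node (Node a b) acc)" by (fact Node.prems(1))
  have clean: "\<forall>i. 0 < i \<and> i < N \<longrightarrow> s i = Atom 0" by (fact Node.prems(2))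
  have A: "dsize acc \<le> A" using Node.prems(3) by (metis append_Nil fold_simps(1))
  have L: "dsize (Node a b) \<le> L" by (fact Node.prems(4))
  let ?test = "IsNode (Fst (Snd (Var 0)))"
  let ?acc = "h x (Node a b) acc"
  let ?s = "s(0 := Node x (Node b ?acc))"
  have nz: "eval ?test s \<noteq> Atom 0" using s0 by simp
  have "\<exists>t. t \<le> poly p (dsize (s 0)) \<and> exec c s t (s(0 := body (s 0)))"
    by (rule runs_tidilyD[OF c]) (use s0 x clean in auto)
  then obtain t where t: "t \<le> poly p (dsize (s 0))" "exec c s t ?s"
    using s0 by (auto simp: body_def)
  have pre: "\<forall>ys zs. spine b = ys @ zs \<longrightarrow> dsize (fold (h x) ys ?acc) \<le> A"
  proof (intro allI impI)
    fix ys zs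
    assume "spine b = ys @ zs"
    then have "spine (Node a b) = (Node a b # ys) @ zs" by simp
    with Node.prems(3) have "dsize (fold (h x) (Node a b # ys) acc) \<le> A" by blast
    then show "dsize (fold (h x) ys ?acc) \<le> A" by simp
  qed
  have b: "dsize b \<le> L" using L by simp
  have s1: "?s 0 = Node x (Node b ?acc)" "\<forall>i. 0 < i \<and> i < N \<longrightarrow> ?s i = Atom 0" using clean by simp_all
  from Node.IH(2)[OF s1 pre b] obtain u where u: "exec (While ?test c) ?s u (?s(0 := Node x (Node (stem b) (fold (h x) (spine b) ?acc))))"
    "u \<le> (length (spine b) + 1) * T" by blast
  have "dsize (s 0) \<le> 2 + dsize x + L + A" using A L s0 by simp
  then have "poly p (dsize (s 0)) \<le> poly p (2 + dsize x + L + A)" by (rule poly_nat_mono)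
  moreover have "etime ?test s \<le> 10 + 3 * (dsize x + L + A)"
    using A L by (simp add: s0 floorlog_def)
  ultimately have "1 + etime ?test s + t + u \<le> (length (spine (Node a b)) + 1) * T"
    using t(1) u(2) by (simp add: T)
  moreover have "exec (While ?test c) s (1 + etime ?test s + t + u)
      (s(0 := Node x (Node (stem (Node a b)) (fold (h x) (spine (Node a b)) acc))))"
    using exec.WhileTrue[OF nz t(2) u(1)] by simp
  ultimately show ?case by blast
qed

text \<open>A polynomial-time step alone would not do, since iterated squaring has exponential
  output size; hence the polynomial bound on every intermediate accumulator.\<close>

lemma ptime_fold_spine:
  assumes l: "ptime D l" and i: "ptime D i"
    and h: "ptime {z. dfst z \<in> D} (\<lambda>z. h (dfst z) (dfst (dsnd z)) (dsnd (dsnd z)))"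
    and size: "\<And>x ys zs. x \<in> D \<Longrightarrow> spine (l x) = ys @ zs \<Longrightarrow>
      dsize (fold (h x) ys (i x)) \<le> poly q (dsize x)"
  shows "ptime D (\<lambda>x. fold (h x) (spine (l x)) (i x))"
proof -
  let ?body = "\<lambda>z. Node (dfst z) (Node (dsnd (dfst (dsnd z))) (h (dfst z) (dfst (dsnd z)) (dsnd (dsnd z))))"
  have "ptime {z. dfst z \<in> D} ?body" by (intro ptime_intros h)
  then obtain c N p where c: "runs_tidily c N p {z. dfst z \<in> D} ?body" unfolding ptime_def by blast
  let ?r = "[:1, 1:] * ([:20, 6:] + 3 * q + pcompose p ([:2, 2:] + q))"
  let ?E = "{Node x (Node (l x) (i x)) | x. x \<in> D}"
  let ?f = "\<lambda>z. Node (dfst z) (Node (stem (dfst (dsnd z)))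
    (fold (h (dfst z)) (spine (dfst (dsnd z))) (dsnd (dsnd z))))"
  have "runs_tidily (While (IsNode (Fst (Snd (Var 0)))) c) N ?r ?E ?f"
    unfolding runs_tidily_def
  proof (intro conjI allI impI)
    show "0 < N" using c unfolding runs_tidily_def by simp
    fix s :: store
    assume "s 0 \<in> ?E" and clean: "\<forall>i. 0 < i \<and> i < N \<longrightarrow> s i = Atom 0"
    then obtain x where x: "x \<in> D" and s0: "s 0 = Node x (Node (l x) (i x))" by blast
    define n A where "n = dsize (s 0)" and "A = poly q n"
    have n: "dsize x \<le> n" "dsize (l x) \<le> n" using s0 by (simp_all add: n_def)
    define T where "T = 20 + 3 * (dsize x + n + A) + poly p (2 + dsize x + n + A)"
    have A: "\<forall>ys zs. spine (l x) = ys @ zs \<longrightarrow> dsize (fold (h x) ys (i x)) \<le> A"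
      using size[OF x] poly_nat_mono[OF n(1), of q] unfolding A_def by (meson le_trans)
    from while_spine_tidy[OF c x T_def s0 clean A n(2)]
    obtain t where t: "exec (While (IsNode (Fst (Snd (Var 0)))) c) s t (s(0 := ?f (s 0)))"
      "t \<le> (length (spine (l x)) + 1) * T" using s0 by auto
    have "poly p (2 + dsize x + n + A) \<le> poly p (2 + 2 * n + A)"
      using n by (intro poly_nat_mono) simp
    then have "T \<le> 20 + 6 * n + 3 * A + poly p (2 + 2 * n + A)" using n by (simp add: T_def)
    moreover have "length (spine (l x)) + 1 \<le> 1 + n" using length_spine_le[of "l x"] n by simp
    ultimately have "(length (spine (l x)) + 1) * T \<le> (1 + n) * (20 + 6 * n + 3 * A + poly p (2 + 2 * n + A))"
      by (intro mult_le_mono)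
    also have "\<dots> = poly ?r n"
    proof -
      have eq: "2 + 2 * n + A = poly ([:2, 2:] + q) n" by (simp add: A_def)
      show ?thesis unfolding eq by (simp add: A_def poly_pcompose algebra_simps)
    qed
    finally show "\<exists>t\<le>poly ?r (dsize (s 0)). exec (While (IsNode (Fst (Snd (Var 0)))) c) s t (s(0 := ?f (s 0)))"
      using t unfolding n_def[symmetric] by (meson le_trans)
  qed
  then have "ptime ?E ?f" unfolding ptime_def by blast
  \<comment> \<open>The loop also returns the context and the end of the list, which are projected
    away here.\<close>
  then have "ptime ?E (\<lambda>z. dsnd (dsnd (?f z)))" by (intro ptime_snd)
  from ptime_comp[OF this ptime_pair[OF ptime_id ptime_pair[OF l i]]] show ?thesis by auto
qed

lemma ptime_fold_items:
  assumes l: "ptime D l" and i: "ptime D i"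
    and h: "ptime {z. dfst z \<in> D} (\<lambda>z. h (dfst z) (dfst (dsnd z)) (dsnd (dsnd z)))"
    and size: "\<And>x ys zs. x \<in> D \<Longrightarrow> items (l x) = ys @ zs \<Longrightarrow>
      dsize (fold (h x) ys (i x)) \<le> poly q (dsize x)"
  shows "ptime D (\<lambda>x. fold (h x) (items (l x)) (i x))"
proof -
  have *: "fold (h x) (map dfst ys) a = fold (\<lambda>y. h x (dfst y)) ys a" for x ys a
    by (simp add: fold_map comp_def)
  have h': "ptime {z. dfst z \<in> D} (\<lambda>z. h (dfst z) (dfst (dfst (dsnd z))) (dsnd (dsnd z)))"
    using ptime_comp[OF h, of "{z. dfst z \<in> D}" "\<lambda>z. Node (dfst z) (Node (dfst (dfst (dsnd z))) (dsnd (dsnd z)))"]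
    by (simp add: ptime_intros)
  have "ptime D (\<lambda>x. fold (\<lambda>y. h x (dfst y)) (spine (l x)) (i x))"
  proof (rule ptime_fold_spine[OF l i h'])
    fix x ys zs
    assume x: "x \<in> D" and eq: "spine (l x) = ys @ zs"
    from eq have "items (l x) = map dfst ys @ map dfst zs" by (simp add: items_eq_map_spine)
    from size[OF x this] show "dsize (fold (\<lambda>y. h x (dfst y)) ys (i x)) \<le> poly q (dsize x)" by (simp add: *)
  qed
  then show ?thesis by (simp add: items_eq_map_spine *)
qed

lemma dsize_fold_additive:
  assumes "\<And>y acc. y \<in> set ys \<Longrightarrow> dsize (g y acc) \<le> dsize acc + B"
  shows "dsize (fold g ys acc) \<le> dsize acc + length ys * B"
  using assms
proof (induction ys arbitrary: acc)
  case (Cons y ys)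
  have "dsize (fold g ys (g y acc)) \<le> dsize (g y acc) + length ys * B"
    using Cons.prems by (intro Cons.IH) auto
  moreover have "dsize (g y acc) \<le> dsize acc + B" using Cons.prems by simp
  ultimately show ?case by simp
qed simp

text \<open>The convenient criterion: if each step enlarges the accumulator by an amount independent
  of the accumulator, the total growth is the number of steps times a polynomial.\<close>

lemma ptime_fold_spine_additive:
  assumes l: "ptime D l" and i: "ptime D i"
    and h: "ptime {z. dfst z \<in> D} (\<lambda>z. h (dfst z) (dfst (dsnd z)) (dsnd (dsnd z)))"
    and size: "\<And>x y acc. x \<in> D \<Longrightarrow> dsize (h x y acc) \<le> dsize acc + poly q (dsize x + dsize y)"
  shows "ptime D (\<lambda>x. fold (h x) (spine (l x)) (i x))"
proof -
  from ptime_dsize[OF l] ptime_dsize[OF i] obtain pl pi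
    where pl: "\<And>x. x \<in> D \<Longrightarrow> dsize (l x) \<le> poly pl (dsize x)"
      and pi: "\<And>x. x \<in> D \<Longrightarrow> dsize (i x) \<le> poly pi (dsize x)" by blast
  show ?thesis
  proof (rule ptime_fold_spine[OF l i h])
    fix x ys zs
    assume x: "x \<in> D" and eq: "spine (l x) = ys @ zs"
    let ?B = "poly q (dsize x + poly pl (dsize x))"
    have "dsize (fold (h x) ys (i x)) \<le> dsize (i x) + length ys * ?B"
    proof (rule dsize_fold_additive)
      fix y acc
      assume "y \<in> set ys"
      then have "dsize y \<le> poly pl (dsize x)"
        using dsize_spine_le[of y "l x"] eq pl[OF x] by simp
      then have "poly q (dsize x + dsize y) \<le> ?B" by (intro poly_nat_mono) simp
      with size[OF x, of y acc] show "dsize (h x y acc) \<le> dsize acc + ?B" by simp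
    qed
    also have "\<dots> \<le> poly pi (dsize x) + poly pl (dsize x) * ?B"
      using pi[OF x] pl[OF x] length_spine_le[of "l x"] eq by (intro add_mono mult_le_mono) auto
    finally show "dsize (fold (h x) ys (i x)) \<le> poly (pi + pl * pcompose q ([:0, 1:] + pl)) (dsize x)"
      by (simp add: poly_pcompose)
  qed
qed

lemma ptime_fold_items_additive:
  assumes l: "ptime D l" and i: "ptime D i"
    and h: "ptime {z. dfst z \<in> D} (\<lambda>z. h (dfst z) (dfst (dsnd z)) (dsnd (dsnd z)))"
    and size: "\<And>x y acc. x \<in> D \<Longrightarrow> dsize (h x y acc) \<le> dsize acc + poly q (dsize x + dsize y)"
  shows "ptime D (\<lambda>x. fold (h x) (items (l x)) (i x))"
proof -
  have h': "ptime {z. dfst z \<in> D} (\<lambda>z. h (dfst z) (dfst (dfst (dsnd z))) (dsnd (dsnd z)))"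
    using ptime_comp[OF h, of "{z. dfst z \<in> D}" "\<lambda>z. Node (dfst z) (Node (dfst (dfst (dsnd z))) (dsnd (dsnd z)))"]
    by (simp add: ptime_intros)
  have "dsize (h x (dfst y) acc) \<le> dsize acc + poly q (dsize x + dsize y)" if "x \<in> D" for x y acc
    using size[OF that, of "dfst y" acc] dsize_dfst[of y]
      poly_nat_mono[of "dsize x + dsize (dfst y)" "dsize x + dsize y" q] by simp
  from ptime_fold_spine_additive[OF l i h' this] show ?thesis
    by (simp add: items_eq_map_spine fold_map comp_def)
qed

text \<open>Made for \<open>Node\<close>, addition and multiplication as \<open>op\<close>; the
  entry-dependent part \<open>F\<close> does not look at the accumulator, so the growth is
  additive.\<close>

lemma ptime_fold_op:
  assumes l: "ptime D l" and i: "ptime D i"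
    and F: "ptime {z. dfst z \<in> D} (\<lambda>z. F (dfst z) (dsnd z))"
    and op: "ptime UNIV (\<lambda>z. op (dfst z) (dsnd z))"
    and size: "\<And>a b. dsize (op a b) \<le> dsize a + dsize b + 1"
  shows "ptime D (\<lambda>x. fold (\<lambda>y. op (F x y)) (spine (l x)) (i x))"
proof -
  let ?E = "{z. dfst z \<in> D}"
  from ptime_dsize[OF F] obtain q where q: "\<And>z. dfst z \<in> D \<Longrightarrow> dsize (F (dfst z) (dsnd z)) \<le> poly q (dsize z)"
    by blast
  have F': "ptime ?E (\<lambda>z. F (dfst z) (dfst (dsnd z)))"
    using ptime_comp[OF F, of ?E "\<lambda>z. Node (dfst z) (dfst (dsnd z))"] by (simp add: ptime_intros)
  have h: "ptime ?E (\<lambda>z. op (F (dfst z) (dfst (dsnd z))) (dsnd (dsnd z)))"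
    using ptime_comp[OF op ptime_pair[OF F', of "\<lambda>z. dsnd (dsnd z)"]] by (simp add: ptime_intros)
  show ?thesis
  proof (rule ptime_fold_spine_additive[OF l i h])
    fix x y acc
    assume "x \<in> D"
    then have "dsize (F x y) \<le> poly q (1 + (dsize x + dsize y))" using q[of "Node x y"] by simp
    with size[of "F x y" acc]
    show "dsize (op (F x y) acc) \<le> dsize acc + poly ([:1:] + pcompose q [:1, 1:]) (dsize x + dsize y)"
      by (simp add: poly_pcompose)
  qed
qed

lemma fold_Node: "fold (\<lambda>y. Node (F y)) ys (enc_list zs) = enc_list (rev (map F ys) @ zs)"
  by (induction ys arbitrary: zs) (simp_all flip: enc_list.simps(2))

text \<open>Consing reverses the list. The algorithm is insensitive to this: its lists are summed,
  searched or counted, or get reversed a second time.\<close>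

lemma ptime_map_spine:
  assumes "ptime D l" and "ptime {z. dfst z \<in> D} (\<lambda>z. F (dfst z) (dsnd z))"
  shows "ptime D (\<lambda>x. enc_list (rev (map (F x) (spine (l x)))))"
  using ptime_fold_op[OF assms(1) ptime_Atom_const[of _ 0] assms(2), of Node]
    fold_Node[of "F _" _ "[]"] by (simp add: ptime_intros)

lemma ptime_comp_items:
  assumes "ptime {z. dfst z \<in> D} (\<lambda>z. F (dfst z) (dsnd z))"
  shows "ptime {z. dfst z \<in> D} (\<lambda>z. F (dfst z) (dfst (dsnd z)))"
  using ptime_comp[OF assms, of "{z. dfst z \<in> D}" "\<lambda>z. Node (dfst z) (dfst (dsnd z))"]
  by (simp add: ptime_intros)

lemma ptime_map_items:
  assumes "ptime D l" and "ptime {z. dfst z \<in> D} (\<lambda>z. F (dfst z) (dsnd z))"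
  shows "ptime D (\<lambda>x. enc_list (rev (map (F x) (items (l x)))))"
  using ptime_map_spine[OF assms(1) ptime_comp_items[OF assms(2)]]
  by (simp add: items_eq_map_spine comp_def)

lemma fold_Atom_add: "fold (\<lambda>y b. Atom (F y + dint b)) ys (Atom a) = Atom (a + (\<Sum>y\<leftarrow>ys. F y))"
  by (induction ys arbitrary: a) simp_all

lemma fold_Atom_mult: "fold (\<lambda>y b. Atom (F y * dint b)) ys (Atom a) = Atom (a * (\<Prod>y\<leftarrow>ys. F y))"
  by (induction ys arbitrary: a) (simp_all add: mult_ac)

lemma ptime_sum:
  assumes "ptime D l" and "ptime {z. dfst z \<in> D} (\<lambda>z. Atom (F (dfst z) (dsnd z)))"
  shows "ptime D (\<lambda>x. Atom (\<Sum>y\<leftarrow>items (l x). F x y))"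
proof -
  have "dsize (Atom (dint a + dint b)) \<le> dsize a + dsize b + 1" for a b
    using dsize_add[of "dint a" "dint b"] dsize_dint[of a] dsize_dint[of b] by linarith
  from ptime_fold_op[OF assms(1) ptime_Atom_const[of _ 0] ptime_comp_items[OF assms(2)],
      of "\<lambda>a b. Atom (dint a + dint b)", OF _ this]
  show ?thesis by (simp add: fold_Atom_add items_eq_map_spine comp_def ptime_intros)
qed

lemma ptime_prod:
  assumes "ptime D l" and "ptime {z. dfst z \<in> D} (\<lambda>z. Atom (F (dfst z) (dsnd z)))"
  shows "ptime D (\<lambda>x. Atom (\<Prod>y\<leftarrow>items (l x). F x y))"
proof -
  have "dsize (Atom (dint a * dint b)) \<le> dsize a + dsize b + 1" for a b
    using dsize_mult[of "dint a" "dint b"] dsize_dint[of a] dsize_dint[of b] by linarith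
  from ptime_fold_op[OF assms(1) ptime_Atom_const[of _ 1] ptime_comp_items[OF assms(2)],
      of "\<lambda>a b. Atom (dint a * dint b)", OF _ this]
  show ?thesis by (simp add: fold_Atom_mult items_eq_map_spine comp_def ptime_intros)
qed

lemma ptime_length:
  assumes "ptime D l"
  shows "ptime D (\<lambda>x. Atom (int (length (items (l x)))))"
  using ptime_sum[OF assms ptime_Atom_const[of _ 1]] by (simp add: sum_list_triv)

section \<open>The algorithm\<close>

text \<open>The fraction \<open>r\<close> times \<open>q\<close>, provided that its denominator
  divides \<open>q\<close>.\<close>

definition scaled :: "int \<Rightarrow> data \<Rightarrow> int" where
  "scaled q r = dint (dfst r) * (q div dint (dsnd r))"

text \<open>A product instead of a least common multiple: it needs no gcd, and its bit length is
  still bounded by the sum of those of the denominators.\<close>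

definition value_den :: "data \<Rightarrow> int" where
  "value_den V = (\<Prod>y\<leftarrow>items V. dint (dsnd (dsnd y)))"

definition weight_den :: "data \<Rightarrow> int" where
  "weight_den W = (\<Prod>y\<leftarrow>items W. dint (dsnd y))"

definition int_values :: "data \<Rightarrow> data" where
  "int_values V =
    enc_list (rev (map (\<lambda>y. Node (dfst y) (Atom (scaled (value_den V) (dsnd y)))) (items V)))"

text \<open>The entry for rank \<open>i\<close> (counted from \<open>1\<close>) holds \<open>w\<^sub>i - w\<^sub>i\<^sub>+\<^sub>1\<close>; past the end of
  the list, \<open>dfst\<close> and \<open>dsnd\<close> return \<open>Atom 0\<close>, hence \<open>w\<^sub>n\<^sub>+\<^sub>1 = 0\<close>.\<close>

definition weight_drops :: "data \<Rightarrow> data" where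
  "weight_drops W = enc_list (rev (map (\<lambda>y.
    Node (Atom (int (length (items W)) - int (length (items y)) + 1))
      (Atom (scaled (weight_den W) (dfst y) - scaled (weight_den W) (dfst (dsnd y))))) (spine W)))"

text \<open>A guess \<open>Node M bits\<close> describes a non-increasing sequence of thresholds: a bit \<open>0\<close> lowers the
  current threshold, which starts at \<open>M\<close>, by the factor \<open>k / (k + 1)\<close>; any other bit assigns it to
  the next block of ranks \<open>m, \<dots>, m + m div k\<close> (counted from \<open>0\<close>). Once the block of \<open>i\<close> has been
  assigned, \<open>threshold_step k i\<close> freezes the state.\<close>

definition threshold_step :: "nat \<Rightarrow> int \<Rightarrow> data \<Rightarrow> data \<Rightarrow> data" where
  "threshold_step k i b st =
    (if dint (dsnd st) \<le> i then
      (if b = Atom 0 then Node (Atom (dint (dfst st) * int k div (int k + 1))) (Atom (dint (dsnd st)))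
       else Node (Atom (dint (dfst st))) (Atom (dint (dsnd st) + 1 + dint (dsnd st) div int k)))
     else st)"

definition threshold :: "nat \<Rightarrow> data \<Rightarrow> int \<Rightarrow> int" where
  "threshold k g i =
    dint (dfst (fold (threshold_step k i) (items (dsnd g)) (Node (Atom (dint (dfst g))) (Atom 0))))"

text \<open>Entries of \<open>C\<close> carry ranks counted from \<open>1\<close>, thresholds are
  indexed from \<open>0\<close>; hence the \<open>- 1\<close>.\<close>

definition penalty :: "nat \<Rightarrow> data \<Rightarrow> data \<Rightarrow> int \<Rightarrow> int" where
  "penalty k C g v = (\<Sum>d\<leftarrow>items C. dint (dsnd d) * max 0 (v - threshold k g (dint (dfst d) - 1)))"

definition offset :: "nat \<Rightarrow> data \<Rightarrow> data \<Rightarrow> int" where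
  "offset k C g = (\<Sum>d\<leftarrow>items C. dint (dsnd d) * (dint (dfst d) * threshold k g (dint (dfst d) - 1)))"

text \<open>The denominator \<open>Atom 1\<close> makes each entry the reduced encoding
  \<open>enc_rat\<close> of an integer, as a min-sum input demands.\<close>

definition penalties :: "nat \<Rightarrow> data \<Rightarrow> data \<Rightarrow> data \<Rightarrow> data" where
  "penalties k C g I = enc_list (rev (map (\<lambda>y.
    Node (dfst y) (Node (Atom (penalty k C g (dint (dsnd y)))) (Atom 1))) (items I)))"

text \<open>Keys occur only once in the lists that are searched, so at most one summand is nonzero;
  the form as a sum lets \<open>ptime_sum\<close> apply.\<close>

definition lookup :: "data \<Rightarrow> data \<Rightarrow> int" where
  "lookup pv e = (\<Sum>y\<leftarrow>items pv. if dfst y = e then dint (dfst (dsnd y)) else 0)"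

text \<open>Iterated \<open>m\<close> times, this attaches all \<open>2 ^ m\<close> bit strings of
  length \<open>m\<close> to each starting guess.\<close>

definition double :: "data \<Rightarrow> data" where
  "double G = fold (\<lambda>g acc. Node (Node (dfst g) (Node (Atom 0) (dsnd g)))
    (Node (Node (dfst g) (Node (Atom 1) (dsnd g))) acc)) (items G) (Atom 0)"

text \<open>A unary numeral for the number of bits of a guess; it is logarithmic in the length of \<open>I\<close>.\<close>

definition bit_count :: "nat \<Rightarrow> data \<Rightarrow> data" where
  "bit_count k I = dsnd (fold (\<lambda>_ st.
    if dint (dfst st) \<le> int (length (items I))
    then Node (Atom (2 * dint (dfst st))) ((Node (Atom 0) ^^ (2 * k)) (dsnd st)) else st)
    (items I) (Node (Atom 1) (enc_list (replicate (k * k + 1) (Atom 0)))))"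

text \<open>The extra guess with maximum \<open>0\<close> serves the empty set, for which no element
  need have value \<open>0\<close>, and keeps the list nonempty when the ground set is
  empty.\<close>

definition guesses :: "nat \<Rightarrow> data \<Rightarrow> data" where
  "guesses k I = fold (\<lambda>_. double) (items (bit_count k I))
    (Node (Node (Atom 0) (Atom 0)) (enc_list (rev (map (\<lambda>y. Node (dsnd y) (Atom 0)) (items I)))))"

text \<open>\<open>env\<close> consists of the instance, the integral values and the weight drops,
  in the layout of \<open>environment\<close>.\<close>

definition query :: "nat \<Rightarrow> data \<Rightarrow> data \<Rightarrow> data" where
  "query k env g = Node (dfst env) (penalties k (dsnd (dsnd env)) g (dfst (dsnd env)))"

text \<open>The key is the upper bound on the scaled norm certified by \<open>g\<close>. The penalty
  of the returned set has to be recomputed, because the min-sum program outputs only the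
  set.\<close>

definition candidate :: "nat \<Rightarrow> (data \<Rightarrow> data) \<Rightarrow> data \<Rightarrow> data \<Rightarrow> data" where
  "candidate k f env g = Node
    (Atom (offset k (dsnd (dsnd env)) g +
      (\<Sum>e\<leftarrow>items (f (query k env g)). lookup (dsnd (query k env g)) e)))
    (f (query k env g))"

text \<open>An accumulator that is not a node means that no candidate has been seen; the fold starts
  from \<open>Atom 0\<close>.\<close>

definition better :: "nat \<Rightarrow> (data \<Rightarrow> data) \<Rightarrow> data \<Rightarrow> data \<Rightarrow> data \<Rightarrow> data" where
  "better k f env g acc =
    (if \<not> is_node acc \<or> dint (dfst (candidate k f env g)) < dint (dfst acc)
     then candidate k f env g else acc)"

definition environment :: "data \<Rightarrow> data" where
  "environment inp =
    Node (dfst inp) (Node (int_values (dfst (dsnd inp))) (weight_drops (dsnd (dsnd inp))))"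

definition ordered_alg :: "nat \<Rightarrow> (data \<Rightarrow> data) \<Rightarrow> data \<Rightarrow> data" where
  "ordered_alg k f inp = dsnd (fold (better k f (environment inp))
    (items (guesses k (dfst (dsnd (environment inp))))) (Atom 0))"

section \<open>Polynomial running time of the algorithm\<close>

lemma ptime_app: "ptime UNIV F \<Longrightarrow> ptime D f \<Longrightarrow> ptime D (\<lambda>x. F (f x))"
  by (rule ptime_comp) auto

lemma ptime_scaled:
  assumes "ptime D (\<lambda>x. Atom (q x))" and "ptime D r"
  shows "ptime D (\<lambda>x. Atom (scaled (q x) (r x)))"
  unfolding scaled_def by (intro ptime_intros assms)

lemma ptime_value_den: "ptime D f \<Longrightarrow> ptime D (\<lambda>x. Atom (value_den (f x)))"
  by (rule ptime_app[of "\<lambda>V. Atom (value_den V)"], unfold value_den_def) (intro ptime_prod ptime_intros)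

lemma ptime_weight_den: "ptime D f \<Longrightarrow> ptime D (\<lambda>x. Atom (weight_den (f x)))"
  by (rule ptime_app[of "\<lambda>V. Atom (weight_den V)"], unfold weight_den_def) (intro ptime_prod ptime_intros)

lemma ptime_int_values: "ptime D f \<Longrightarrow> ptime D (\<lambda>x. int_values (f x))"
  by (rule ptime_app[of int_values], unfold int_values_def)
    (intro ptime_map_items ptime_scaled ptime_value_den ptime_intros)

lemma ptime_weight_drops: "ptime D f \<Longrightarrow> ptime D (\<lambda>x. weight_drops (f x))"
  by (rule ptime_app[of weight_drops], unfold weight_drops_def)
    (intro ptime_map_spine ptime_scaled ptime_weight_den ptime_length ptime_intros)

lemma threshold_step_Node [simp]:
  "threshold_step k i b (Node (Atom t) (Atom m)) =
    (if m \<le> i then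
      (if b = Atom 0 then Node (Atom (t * int k div (int k + 1))) (Atom m)
       else Node (Atom t) (Atom (m + 1 + m div int k)))
     else Node (Atom t) (Atom m))"
  by (simp add: threshold_step_def)

text \<open>Freezing keeps the state small: the rank is last raised from some
  \<open>m \<le> i\<close>, hence to at most \<open>2 * i + 1\<close>, and lowering never increases
  the absolute value. Negative \<open>M\<close> and \<open>i\<close> are included because the time
  bound is shown for all data.\<close>

lemma threshold_invariant:
  assumes "0 < k"
  shows "\<exists>t m. fold (threshold_step k i) bs (Node (Atom M) (Atom 0)) = Node (Atom t) (Atom m) \<and>
    \<bar>t\<bar> \<le> \<bar>M\<bar> \<and> (0 \<le> M \<longrightarrow> 0 \<le> t) \<and> 0 \<le> m \<and> m \<le> 2 * \<bar>i\<bar> + 1"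
proof (induction bs rule: rev_induct)
  case Nil
  then show ?case by auto
next
  case (snoc b bs)
  from snoc.IH obtain t m where st: "fold (threshold_step k i) bs (Node (Atom M) (Atom 0)) = Node (Atom t) (Atom m)"
    and tm: "\<bar>t\<bar> \<le> \<bar>M\<bar>" "0 \<le> M \<longrightarrow> 0 \<le> t" "0 \<le> m" "m \<le> 2 * \<bar>i\<bar> + 1" by blast
  have "\<bar>t * int k div (int k + 1)\<bar> \<le> \<bar>t\<bar>"
  proof (cases "0 \<le> t")
    case True
    then have "t * int k \<le> t * (int k + 1)" by (simp add: algebra_simps)
    then have "t * int k div (int k + 1) \<le> t * (int k + 1) div (int k + 1)" by (intro zdiv_mono1) auto
    with True show ?thesis by (simp add: pos_imp_zdiv_nonneg_iff)
  next
    case False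
    then have "t * (int k + 1) \<le> t * int k" by (simp add: algebra_simps)
    then have "t * (int k + 1) div (int k + 1) \<le> t * int k div (int k + 1)" by (intro zdiv_mono1) auto
    moreover have "t * int k div (int k + 1) \<le> 0"
      using False by (intro div_nonpos_pos_le0) (auto simp: mult_nonpos_nonneg)
    ultimately show ?thesis using False by simp
  qed
  moreover have "0 \<le> t * int k div (int k + 1)" if "0 \<le> M" using that tm by (simp add: pos_imp_zdiv_nonneg_iff)
  moreover have "m + 1 + m div int k \<le> 2 * \<bar>i\<bar> + 1" if "m \<le> i"
  proof -
    have "m div int k \<le> m" using abs_div_le[of m "int k"] tm(3) by simp
    with that show ?thesis by simp
  qed
  moreover have "0 \<le> m div int k" using tm(3) assms by (simp add: pos_imp_zdiv_nonneg_iff)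
  ultimately show ?case using tm by (auto simp: st)
qed

lemma ptime_threshold_pair:
  assumes "0 < k"
  shows "ptime UNIV (\<lambda>z. Atom (threshold k (dfst z) (dint (dsnd z))))"
proof -
  have "ptime UNIV (\<lambda>z. fold (threshold_step k (dint (dsnd z))) (items (dsnd (dfst z)))
    (Node (Atom (dint (dfst (dfst z)))) (Atom 0)))"
  proof (rule ptime_fold_items)
    show "ptime {z. dfst z \<in> UNIV} (\<lambda>z. threshold_step k (dint (dsnd (dfst z))) (dfst (dsnd z)) (dsnd (dsnd z)))"
      unfolding threshold_step_def by (intro ptime_intros)
    fix z ys zs
    let ?M = "dint (dfst (dfst z))" and ?i = "dint (dsnd z)"
    obtain t m where st: "fold (threshold_step k ?i) ys (Node (Atom ?M) (Atom 0)) = Node (Atom t) (Atom m)"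
      and t: "\<bar>t\<bar> \<le> \<bar>?M\<bar>" and m: "0 \<le> m" "m \<le> 2 * \<bar>?i\<bar> + 1"
      using threshold_invariant[OF assms] by blast
    have "dsize (Atom t) \<le> dsize (Atom ?M)" using t by (rule dsize_Atom_mono)
    also have "\<dots> \<le> dsize z" using dsize_dint dsize_dfst le_trans by blast
    finally have 1: "dsize (Atom t) \<le> dsize z" .
    have "dsize (Atom m) \<le> dsize (Atom (\<bar>?i\<bar> + (\<bar>?i\<bar> + 1)))" using m by (intro dsize_Atom_mono) simp
    also have "\<dots> \<le> dsize (Atom \<bar>?i\<bar>) + (dsize (Atom \<bar>?i\<bar>) + dsize (Atom 1))"
      using dsize_add[of "\<bar>?i\<bar>" "\<bar>?i\<bar> + 1"] dsize_add[of "\<bar>?i\<bar>" 1] by linarith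
    finally have "dsize (Atom m) \<le> 2 * dsize (Atom ?i) + dsize (Atom 1)" by simp
    moreover have "dsize (Atom ?i) \<le> dsize z" using dsize_dint dsize_dsnd le_trans by blast
    ultimately have "dsize (Atom m) \<le> 2 * dsize z + dsize (Atom 1)" by linarith
    with 1 show "dsize (fold (threshold_step k ?i) ys (Node (Atom ?M) (Atom 0)))
        \<le> poly [:1 + dsize (Atom 1), 3:] (dsize z)"
      unfolding st by simp
  qed (intro ptime_intros)+
  then show ?thesis unfolding threshold_def by (intro ptime_intros)
qed

lemma ptime_threshold:
  assumes "0 < k" and "ptime D g" and "ptime D (\<lambda>x. Atom (i x))"
  shows "ptime D (\<lambda>x. Atom (threshold k (g x) (i x)))"
  using ptime_app[OF ptime_threshold_pair[OF assms(1)] ptime_pair[OF assms(2,3)]] by simp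

lemma ptime_penalty:
  assumes k: "0 < k" and "ptime D C" and "ptime D g" and "ptime D (\<lambda>x. Atom (v x))"
  shows "ptime D (\<lambda>x. Atom (penalty k (C x) (g x) (v x)))"
proof -
  have "ptime UNIV (\<lambda>z. Atom (penalty k (dfst z) (dfst (dsnd z)) (dint (dsnd (dsnd z)))))"
    unfolding penalty_def by (intro ptime_sum ptime_threshold[OF k] ptime_intros)
  from ptime_app[OF this ptime_pair[OF assms(2) ptime_pair[OF assms(3,4)]]] show ?thesis by simp
qed

lemma ptime_offset:
  assumes k: "0 < k" and "ptime D C" and "ptime D g"
  shows "ptime D (\<lambda>x. Atom (offset k (C x) (g x)))"
proof -
  have "ptime UNIV (\<lambda>z. Atom (offset k (dfst z) (dsnd z)))"
    unfolding offset_def by (intro ptime_sum ptime_threshold[OF k] ptime_intros)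
  from ptime_app[OF this ptime_pair[OF assms(2,3)]] show ?thesis by simp
qed

lemma ptime_penalties:
  assumes k: "0 < k" and "ptime D C" and "ptime D g" and "ptime D I"
  shows "ptime D (\<lambda>x. penalties k (C x) (g x) (I x))"
proof -
  have "ptime UNIV (\<lambda>z. penalties k (dfst z) (dfst (dsnd z)) (dsnd (dsnd z)))"
    unfolding penalties_def by (intro ptime_map_items ptime_penalty[OF k] ptime_intros)
  from ptime_app[OF this ptime_pair[OF assms(2) ptime_pair[OF assms(3,4)]]] show ?thesis by simp
qed

lemma ptime_lookup:
  assumes "ptime D pv" and "ptime D e"
  shows "ptime D (\<lambda>x. Atom (lookup (pv x) (e x)))"
proof -
  have "ptime UNIV (\<lambda>z. Atom (lookup (dfst z) (dsnd z)))"
    unfolding lookup_def by (intro ptime_sum ptime_intros)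
  from ptime_app[OF this ptime_pair[OF assms]] show ?thesis by simp
qed

lemma dsize_dfst_dsnd: "dsize (dfst d) + dsize (dsnd d) \<le> dsize d + 1"
  by (cases d) (auto simp: floorlog_def)

lemma dsize_01: "dsize (Atom 0) = 1" "dsize (Atom 1) = 2"
  by (simp_all add: floorlog_def compute_floorlog)

lemma ptime_double: "ptime D G \<Longrightarrow> ptime D (\<lambda>x. double (G x))"
proof (rule ptime_app[of double])
  have "ptime UNIV (\<lambda>G. fold (\<lambda>g acc. Node (Node (dfst g) (Node (Atom 0) (dsnd g)))
    (Node (Node (dfst g) (Node (Atom 1) (dsnd g))) acc)) (items G) (Atom 0))"
  proof (rule ptime_fold_items_additive)
    fix x y acc :: data
    have "dsize (Node (Node (dfst y) (Node (Atom 0) (dsnd y))) (Node (Node (dfst y) (Node (Atom 1) (dsnd y))) acc))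
      \<le> dsize acc + 20 + 2 * (dsize (dfst y) + dsize (dsnd y))"
      by (simp add: dsize_01 del: dsize.simps(1))
    then show "dsize (Node (Node (dfst y) (Node (Atom 0) (dsnd y))) (Node (Node (dfst y) (Node (Atom 1) (dsnd y))) acc))
      \<le> dsize acc + poly [:22, 2:] (dsize x + dsize y)"
      using dsize_dfst_dsnd[of y] by simp
  qed (intro ptime_intros)+
  then show "ptime UNIV double" unfolding double_def .
qed

lemma dsize_double: "dsize (double G) \<le> 16 * dsize G"
proof -
  have "dsize (fold (\<lambda>g acc. Node (Node (dfst g) (Node (Atom 0) (dsnd g)))
    (Node (Node (dfst g) (Node (Atom 1) (dsnd g))) acc)) (items G) acc) \<le> dsize acc + 15 * dsize G" for acc
  proof (induction G arbitrary: acc)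
    case (Node g G)
    let ?acc = "Node (Node (dfst g) (Node (Atom 0) (dsnd g))) (Node (Node (dfst g) (Node (Atom 1) (dsnd g))) acc)"
    have "dsize ?acc \<le> dsize acc + 9 + 2 * (dsize (dfst g) + dsize (dsnd g))"
      by (simp add: dsize_01 del: dsize.simps(1))
    also have "\<dots> \<le> dsize acc + 15 * (1 + dsize g)" using dsize_dfst_dsnd[of g] by simp
    finally show ?case using Node.IH(2)[of ?acc] by simp
  qed simp
  from this[of "Atom 0"] show ?thesis using dsize_ge1[of G] by (simp add: double_def dsize_01 del: dsize.simps(1))
qed

lemma funpow_Node_items: "items ((Node a ^^ m) d) = replicate m a @ items d"
  by (induction m) auto

lemma ptime_funpow_Node: "ptime D f \<Longrightarrow> ptime D (\<lambda>x. (Node (Atom i) ^^ m) (f x))"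
  by (induction m) (auto intro: ptime_intros)

lemma dsize_funpow_Node: "dsize ((Node (Atom 0) ^^ m) d) = 2 * m + dsize d"
  by (induction m) (auto simp: floorlog_def)

lemma ptime_bit_count: "ptime D I \<Longrightarrow> ptime D (\<lambda>x. bit_count k (I x))"
proof (rule ptime_app[of "bit_count k"])
  let ?h = "\<lambda>I _ st. if dint (dfst st) \<le> int (length (items I))
    then Node (Atom (2 * dint (dfst st))) ((Node (Atom 0) ^^ (2 * k)) (dsnd st)) else st"
  have "ptime UNIV (\<lambda>I. fold (?h I) (items I) (Node (Atom 1) (enc_list (replicate (k * k + 1) (Atom 0)))))"
  proof (rule ptime_fold_items_additive)
    show "ptime {z. dfst z \<in> UNIV} (\<lambda>z. ?h (dfst z) (dfst (dsnd z)) (dsnd (dsnd z)))"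
      by (intro ptime_funpow_Node ptime_length ptime_intros)
    fix I y st :: data
    have "dsize (Atom (2 * dint (dfst st))) \<le> dsize (Atom 2) + dsize (dfst st)"
      using dsize_mult[of 2 "dint (dfst st)"] dsize_dint[of "dfst st"] by linarith
    then show "dsize (?h I y st) \<le> dsize st + poly [:2 + dsize (Atom 2) + 4 * k:] (dsize I + dsize y)"
      using dsize_dfst_dsnd[of st] by (simp add: dsize_funpow_Node del: dsize.simps(1))
  qed (intro ptime_intros)+
  then show "ptime UNIV (bit_count k)" unfolding bit_count_def by (intro ptime_intros)
qed

text \<open>The lower bound on \<open>2 ^ l\<close> provides enough bits for a good guess, the upper
  bound keeps the number of guesses polynomial.\<close>

lemma bit_count_length:
  "\<exists>l. length (items (bit_count k I)) = k * k + 1 + 2 * k * l \<and>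
    length (items I) < 2 ^ l \<and> 2 ^ l \<le> 2 * length (items I) + 1"
proof -
  let ?n = "length (items I)"
  let ?h = "\<lambda>_ st. if dint (dfst st) \<le> int ?n
    then Node (Atom (2 * dint (dfst st))) ((Node (Atom 0) ^^ (2 * k)) (dsnd st)) else st"
  let ?i = "Node (Atom 1) (enc_list (replicate (k * k + 1) (Atom 0)))"
  \<comment> \<open>Either every step so far has doubled the counter, or the counter already exceeds
    \<open>?n\<close>. After \<open>?n\<close> steps the first alternative also gives
    \<open>?n < 2 ^ ?n\<close>. A doubling happens only from at most \<open>?n\<close>, which yields
    the upper bound; the \<open>+ 1\<close> covers \<open>l = 0\<close>.\<close>
  have "\<exists>l d. fold ?h ys ?i = Node (Atom (2 ^ l)) d \<and> length (items d) = k * k + 1 + 2 * k * l \<and>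
    2 ^ l \<le> 2 * ?n + 1 \<and> (l = length ys \<or> ?n < 2 ^ l)" for ys :: "data list"
  proof (induction ys rule: rev_induct)
    case Nil
    show ?case
      by (intro exI[of _ 0] exI[of _ "enc_list (replicate (k * k + 1) (Atom 0))"])
        (simp del: replicate_Suc)
  next
    case (snoc y ys)
    then obtain l d where ld: "fold ?h ys ?i = Node (Atom (2 ^ l)) d" "length (items d) = k * k + 1 + 2 * k * l"
      "2 ^ l \<le> 2 * ?n + 1" "l = length ys \<or> ?n < 2 ^ l" by blast
    show ?case
    proof (cases "2 ^ l \<le> ?n")
      case True
      then have le: "(2::int) ^ l \<le> int ?n" using of_nat_le_iff[of "2 ^ l" ?n, where 'a = int] by simp
      have "fold ?h (ys @ [y]) ?i = Node (Atom (2 ^ Suc l)) ((Node (Atom 0) ^^ (2 * k)) d)"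
        using le by (simp only: fold_append comp_apply ld(1) fold_simps) simp
      moreover have "l = length ys" using ld(4) True by simp
      ultimately show ?thesis using True ld(2)
        by (intro exI[of _ "Suc l"] exI[of _ "(Node (Atom 0) ^^ (2 * k)) d"]) (simp add: funpow_Node_items)
    next
      case False
      then have "\<not> (2::int) ^ l \<le> int ?n" using of_nat_le_iff[of "2 ^ l" ?n, where 'a = int] by simp
      then have "fold ?h (ys @ [y]) ?i = Node (Atom (2 ^ l)) d"
        by (simp only: fold_append comp_apply ld(1) fold_simps) simp
      then show ?thesis using False ld(2,3) by (intro exI[of _ l] exI[of _ d]) simp
    qed
  qed
  from this[of "items I"] obtain l d where ld: "fold ?h (items I) ?i = Node (Atom (2 ^ l)) d"
    "length (items d) = k * k + 1 + 2 * k * l" "2 ^ l \<le> 2 * ?n + 1" "l = ?n \<or> ?n < 2 ^ l" by blast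
  from ld(1) have "bit_count k I = d" by (simp only: bit_count_def dsnd.simps)
  moreover from ld(4) have "?n < 2 ^ l" by (auto intro: less_exp)
  ultimately show ?thesis using ld by blast
qed

text \<open>The list grows by a constant factor per round, so the additive criterion for folds is
  not applicable. Polynomial size comes from the logarithmic number of rounds:
  \<open>16 ^ (2 * k * l)\<close> equals \<open>(2 ^ l) ^ (8 * k)\<close>, where
  \<open>2 ^ l\<close> is linear in the length of the input and \<open>k\<close> is fixed.\<close>

lemma ptime_guesses: "ptime D I \<Longrightarrow> ptime D (\<lambda>x. guesses k (I x))"
proof (rule ptime_app[of "guesses k"])
  let ?start = "\<lambda>I. Node (Node (Atom 0) (Atom 0)) (enc_list (rev (map (\<lambda>y. Node (dsnd y) (Atom 0)) (items I))))"
  have start: "ptime UNIV ?start" by (intro ptime_map_items ptime_intros)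
  then obtain q where q: "\<And>I. dsize (?start I) \<le> poly q (dsize I)" using ptime_dsize by blast
  have "ptime UNIV (\<lambda>I. fold (\<lambda>_. double) (items (bit_count k I)) (?start I))"
  proof (rule ptime_fold_items)
    show "ptime UNIV (bit_count k)" by (intro ptime_bit_count ptime_id)
    show "ptime UNIV ?start" by (rule start)
    show "ptime {z. dfst z \<in> UNIV} (\<lambda>z. double (dsnd (dsnd z)))" by (intro ptime_double ptime_intros)
    fix I ys zs
    assume eq: "items (bit_count k I) = ys @ zs"
    obtain l where l: "length (items (bit_count k I)) = k * k + 1 + 2 * k * l"
      "2 ^ l \<le> 2 * length (items I) + 1" using bit_count_length[of k I] by blast
    have "dsize (fold (\<lambda>_. double) ys G) \<le> 16 ^ length ys * dsize G" for G
    proof (induction ys arbitrary: G)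
      case (Cons y ys)
      have "dsize (fold (\<lambda>_. double) ys (double G)) \<le> 16 ^ length ys * dsize (double G)" by (rule Cons.IH)
      also have "\<dots> \<le> 16 ^ length ys * (16 * dsize G)" by (intro mult_le_mono2 dsize_double)
      finally show ?case by simp
    qed simp
    from this[of "?start I"] have "dsize (fold (\<lambda>_. double) ys (?start I)) \<le> 16 ^ length ys * dsize (?start I)" .
    also have "\<dots> \<le> 16 ^ (k * k + 1 + 2 * k * l) * poly q (dsize I)"
      using q[of I] eq l(1) by (intro mult_le_mono power_increasing) auto
    also have "(16::nat) ^ (k * k + 1 + 2 * k * l) = 16 ^ (k * k + 1) * (2 ^ l) ^ (8 * k)"
    proof -
      have "(16::nat) = 2 ^ 4" by simp
      then show ?thesis by (simp only: power_add power_mult[symmetric]) (simp add: ac_simps)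
    qed
    also have "\<dots> \<le> 16 ^ (k * k + 1) * (1 + 2 * dsize I) ^ (8 * k)"
      using l(2) length_spine_le[of I] by (intro mult_le_mono2 power_mono) (auto simp: items_eq_map_spine)
    finally show "dsize (fold (\<lambda>_. double) ys (?start I)) \<le>
        poly ([:16 ^ (k * k + 1):] * [:1, 2:] ^ (8 * k) * q) (dsize I)"
      by (simp add: mult_ac)
  qed
  then show "ptime UNIV (guesses k)" unfolding guesses_def .
qed

text \<open>Queries have to be valid for every \<open>g\<close>, because the domain of a fold step
  restricts only the context and not the list entry. This is possible as penalties are nonnegative
  for arbitrary thresholds.\<close>

lemma ptime_candidate:
  assumes k: "0 < k" and f: "ptime E f" and E: "\<And>env g. env \<in> D \<Longrightarrow> query k env g \<in> E"
  shows "ptime {z. dfst z \<in> D} (\<lambda>z. candidate k f (dfst z) (dsnd z))"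
proof -
  let ?D = "{z. dfst z \<in> D}"
  have q: "ptime ?D (\<lambda>z. query k (dfst z) (dsnd z))"
    unfolding query_def by (intro ptime_penalties[OF k] ptime_intros)
  then have fq: "ptime ?D (\<lambda>z. f (query k (dfst z) (dsnd z)))" by (rule ptime_comp[OF f]) (auto simp: E)
  have "ptime UNIV (\<lambda>z. Atom (\<Sum>e\<leftarrow>items (dfst z). lookup (dsnd z) e))"
    by (intro ptime_sum ptime_lookup ptime_intros)
  from ptime_app[OF this ptime_pair[OF fq ptime_snd[OF q]]]
  have "ptime ?D (\<lambda>z. Atom (\<Sum>e\<leftarrow>items (f (query k (dfst z) (dsnd z))). lookup (dsnd (query k (dfst z) (dsnd z))) e))"
    by simp
  then show ?thesis
    unfolding candidate_def by (intro ptime_pair ptime_add ptime_offset[OF k] fq) (intro ptime_intros)+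
qed

lemma ptime_ordered_alg:
  assumes k: "0 < k" and f: "ptime E f" and E: "\<And>inp g. inp \<in> D \<Longrightarrow> query k (environment inp) g \<in> E"
  shows "ptime D (ordered_alg k f)"
proof -
  let ?D = "environment ` D"
  have cand: "ptime {z. dfst z \<in> ?D} (\<lambda>z. candidate k f (dfst z) (dsnd z))"
    by (rule ptime_candidate[OF k f]) (auto simp: E)
  then obtain q where q: "\<And>z. dfst z \<in> ?D \<Longrightarrow> dsize (candidate k f (dfst z) (dsnd z)) \<le> poly q (dsize z)"
    using ptime_dsize by blast
  have "ptime ?D (\<lambda>env. fold (better k f env) (items (guesses k (dfst (dsnd env)))) (Atom 0))"
  proof (rule ptime_fold_items_additive)
    show "ptime {z. dfst z \<in> ?D} (\<lambda>z. better k f (dfst z) (dfst (dsnd z)) (dsnd (dsnd z)))"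
      unfolding better_def by (intro ptime_comp_items[OF cand] ptime_intros)
    fix env g acc
    assume "env \<in> ?D"
    then have "dsize (candidate k f env g) \<le> poly q (1 + (dsize env + dsize g))"
      using q[of "Node env g"] by simp
    then show "dsize (better k f env g acc) \<le> dsize acc + poly (pcompose q [:1, 1:]) (dsize env + dsize g)"
      by (simp add: better_def poly_pcompose)
  qed (intro ptime_guesses ptime_intros)+
  then have "ptime ?D (\<lambda>env. dsnd (fold (better k f env) (items (guesses k (dfst (dsnd env)))) (Atom 0)))"
    by (rule ptime_snd)
  moreover have "ptime D environment"
    unfolding environment_def by (intro ptime_int_values ptime_weight_drops ptime_intros)
  ultimately show ?thesis
    unfolding ordered_alg_def by (rule ptime_comp) auto
qed

section \<open>Threshold bounds for the ordered norm\<close>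

text \<open>Summation by parts: both sides add \<open>c j * x i\<close> over all
  \<open>i \<le> j < n\<close>.\<close>

lemma weighted_sum_by_drops:
  fixes c x :: "nat \<Rightarrow> 'a :: comm_ring_1"
  shows "(\<Sum>i<n. (\<Sum>j=i..<n. c j) * x i) = (\<Sum>j<n. c j * (\<Sum>i\<le>j. x i))"
proof (induction n)
  case (Suc n)
  have "(\<Sum>i<Suc n. (\<Sum>j=i..<Suc n. c j) * x i) = (\<Sum>i<Suc n. (\<Sum>j=i..<n. c j) * x i + c n * x i)"
    by (intro sum.cong refl) (simp add: distrib_right)
  also have "\<dots> = (\<Sum>i<n. (\<Sum>j=i..<n. c j) * x i) + c n * (\<Sum>i<Suc n. x i)"
    unfolding sum.distrib sum_distrib_left by simp
  also have "(\<Sum>i<Suc n. x i) = (\<Sum>i\<le>n. x i)" by (simp only: lessThan_Suc_atMost)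
  finally show ?case using Suc.IH by simp
qed simp

text \<open>Holds termwise, as \<open>x j\<close> is at most \<open>t\<close> plus its excess over
  \<open>t\<close>; the excesses at ranks beyond \<open>i\<close> are nonnegative.\<close>

lemma top_sum_le_threshold:
  fixes x :: "nat \<Rightarrow> int"
  assumes "i < n"
  shows "(\<Sum>j\<le>i. x j) \<le> (int i + 1) * t + (\<Sum>j<n. max 0 (x j - t))"
proof -
  have "(\<Sum>j\<le>i. x j) \<le> (\<Sum>j\<le>i. t + max 0 (x j - t))" by (intro sum_mono) auto
  also have "\<dots> = (int i + 1) * t + (\<Sum>j\<le>i. max 0 (x j - t))" by (simp add: sum.distrib algebra_simps)
  also have "(\<Sum>j\<le>i. max 0 (x j - t)) \<le> (\<Sum>j<n. max 0 (x j - t))"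
    using assms by (intro sum_mono2) auto
  finally show ?thesis by simp
qed

text \<open>\<open>a\<close> is the first rank of the block of \<open>i\<close>. The condition
  \<open>x a \<le> t\<close> ensures that no rank from \<open>a\<close> on exceeds the threshold;
  the last summand allows for the bottom of the grid.\<close>

definition good_threshold :: "nat \<Rightarrow> nat \<Rightarrow> (nat \<Rightarrow> int) \<Rightarrow> nat \<Rightarrow> int \<Rightarrow> bool" where
  "good_threshold k n x i t \<longleftrightarrow> (\<exists>a\<le>i. i \<le> a + a div k \<and> x a \<le> t \<and>
    real_of_int t \<le> (1 + 1 / real k) * real_of_int (x a) + real_of_int (x 0) / (real k * real n))"

text \<open>Only the \<open>a\<close> ranks before the block have an excess, and their subtrahends
  cancel \<open>a\<close> of the \<open>i + 1\<close> copies of \<open>t\<close>. The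
  \<open>i + 1 - a\<close> remaining copies are compared with \<open>x a\<close>, and all but one of
  them are charged to the earlier, larger entries.\<close>

lemma good_threshold_le_top_sum:
  fixes x :: "nat \<Rightarrow> int"
  assumes k: "0 < k" and i: "i < n"
    and mono: "\<And>i j. i \<le> j \<Longrightarrow> j < n \<Longrightarrow> x j \<le> x i" and nonneg: "\<And>i. i < n \<Longrightarrow> 0 \<le> x i"
    and good: "good_threshold k n x i t"
  shows "(real i + 1) * real_of_int t + (\<Sum>j<n. max 0 (real_of_int (x j) - real_of_int t))
    \<le> ((1 + 1 / real k)\<^sup>2 + 1 / real k) * (\<Sum>j\<le>i. real_of_int (x j))"
proof -
  define d where "d = 1 / real k"
  define y where "y j = real_of_int (x j)" for j
  define e where "e = y 0 / (real k * real n)"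
  define s where "s = real_of_int t"
  have d: "0 < d" using k by (simp add: d_def)
  from good obtain a where a: "a \<le> i" "i \<le> a + a div k" "x a \<le> t" "s \<le> (1 + d) * y a + e"
    unfolding good_threshold_def d_def y_def e_def s_def by blast
  have ymono: "y j \<le> y i" if "i \<le> j" "j < n" for i j using mono[OF that] by (simp add: y_def)
  have ynn: "0 \<le> y j" if "j < n" for j using nonneg[OF that] by (simp add: y_def)
  have e: "0 \<le> e" using ynn[of 0] i by (simp add: e_def)
  have "y a \<le> s" using a(3) by (simp add: y_def s_def)
  have a_n: "a < n" using a(1) i by simp
  have "(\<Sum>j<n. max 0 (y j - s)) = (\<Sum>j<a. max 0 (y j - s))"
  proof (rule sum.mono_neutral_right)
    show "\<forall>j\<in>{..<n} - {..<a}. max 0 (y j - s) = 0"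
    proof
      fix j assume "j \<in> {..<n} - {..<a}"
      then have "y j \<le> s" using ymono[of a j] \<open>y a \<le> s\<close> by simp
      then show "max 0 (y j - s) = 0" by simp
    qed
  qed (use a_n in auto)
  \<comment> \<open>Enlarging \<open>y j\<close> to \<open>(1 + d) * y j + e\<close> makes the
    difference from \<open>s\<close> nonnegative, because \<open>y a \<le> y j\<close>; so
    \<open>max\<close> disappears and \<open>s\<close> can cancel.\<close>
  also have "\<dots> \<le> (\<Sum>j<a. (1 + d) * y j + e - s)"
  proof (rule sum_mono)
    fix j assume "j \<in> {..<a}"
    then have j: "y a \<le> y j" "0 \<le> y j" using ymono[of j a] ynn[of j] a_n by auto
    have "s \<le> (1 + d) * y j + e" using a(4) mult_left_mono[OF j(1), of "1 + d"] d by linarith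
    moreover have "0 \<le> d * y j" using j d by simp
    then have "y j \<le> (1 + d) * y j + e" using e by (simp add: algebra_simps)
    ultimately show "max 0 (y j - s) \<le> (1 + d) * y j + e - s" by simp
  qed
  also have "\<dots> = (1 + d) * (\<Sum>j<a. y j) + real a * (e - s)"
    by (simp add: sum.distrib sum_subtractf sum_distrib_left algebra_simps)
  finally have 1: "(real i + 1) * s + (\<Sum>j<n. max 0 (y j - s))
      \<le> (1 + d) * (\<Sum>j<a. y j) + real a * e + (real i + 1 - real a) * s"
    by (simp add: algebra_simps)
  have "(real i + 1 - real a) * s \<le> (real i + 1 - real a) * ((1 + d) * y a + e)"
    using a(1,4) by (intro mult_left_mono) auto
  with 1 have 2: "(real i + 1) * s + (\<Sum>j<n. max 0 (y j - s))
      \<le> (1 + d) * ((\<Sum>j<a. y j) + (real i + 1 - real a) * y a) + (real i + 1) * e"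
    by (simp add: algebra_simps)
  \<comment> \<open>The block has at most \<open>a div k\<close> ranks after \<open>a\<close>; their
    cost is spread over the first \<open>a\<close> ranks, each of value at least
    \<open>y a\<close>.\<close>
  have "real i - real a \<le> d * real a"
  proof -
    have "real i \<le> real a + real (a div k)" using a(2) by linarith
    also have "real (a div k) \<le> real a / real k" by (simp add: of_nat_div_le_of_nat)
    finally show ?thesis by (simp add: d_def)
  qed
  then have "(real i - real a) * y a \<le> d * real a * y a" using ynn[OF a_n] by (rule mult_right_mono)
  also have "real a * y a \<le> (\<Sum>j<a. y j)"
    using sum_mono[of "{..<a}" "\<lambda>_. y a" y] ymono[of _ a] a_n by simp
  then have "d * real a * y a \<le> d * (\<Sum>j<a. y j)" using d by simp
  finally have "(\<Sum>j<a. y j) + (real i + 1 - real a) * y a \<le> (1 + d) * (\<Sum>j<a. y j) + y a"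
    by (simp add: algebra_simps)
  also have "\<dots> \<le> (1 + d) * ((\<Sum>j<a. y j) + y a)" using d ynn[OF a_n] by (simp add: algebra_simps)
  also have "(\<Sum>j<a. y j) + y a = (\<Sum>j\<le>a. y j)" by (simp add: lessThan_Suc_atMost[symmetric])
  also have "\<dots> \<le> (\<Sum>j\<le>i. y j)" using a(1) i ynn by (intro sum_mono2) auto
  finally have "(\<Sum>j<a. y j) + (real i + 1 - real a) * y a \<le> (1 + d) * (\<Sum>j\<le>i. y j)" using d by simp
  then have 3: "(1 + d) * ((\<Sum>j<a. y j) + (real i + 1 - real a) * y a) \<le> (1 + d)\<^sup>2 * (\<Sum>j\<le>i. y j)"
    using d by (simp add: power2_eq_square mult.assoc)
  \<comment> \<open>At most \<open>n\<close> copies of the slack \<open>e\<close> occur, together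
    \<open>y 0 / k\<close>, and \<open>y 0\<close> belongs to every top sum.\<close>
  have "(real i + 1) * e \<le> real n * e" using i e by (intro mult_right_mono) auto
  also have "\<dots> = d * y 0" using i by (simp add: e_def d_def)
  also have "y 0 \<le> (\<Sum>j\<le>i. y j)" using i ynn by (intro member_le_sum) auto
  then have "d * y 0 \<le> d * (\<Sum>j\<le>i. y j)" using d by simp
  finally have "(real i + 1) * s + (\<Sum>j<n. max 0 (y j - s)) \<le> ((1 + d)\<^sup>2 + d) * (\<Sum>j\<le>i. y j)"
    using 2 3 by (simp add: algebra_simps)
  then show ?thesis by (simp add: d_def y_def s_def)
qed

section \<open>Existence of a good guess\<close>

text \<open>The summand \<open>1\<close> gives progress from rank \<open>0\<close> and makes up for
  the rounding of \<open>div\<close>, so that ranks grow at least by the factor 1 + 1/k.\<close>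

definition next_block :: "nat \<Rightarrow> nat \<Rightarrow> nat" where
  "next_block k m = m + 1 + m div k"

definition lower :: "nat \<Rightarrow> int \<Rightarrow> int" where
  "lower k t = t * int k div (int k + 1)"

text \<open>Thus \<open>k\<close> steps gain a factor of two. Applied to ranks and to the grid, this
  is the origin of \<open>2 * k * l\<close> in the number of bits.\<close>

lemma Bernoulli_two: "0 < k \<Longrightarrow> 2 \<le> (1 + 1 / real k) ^ k"
  using Bernoulli_inequality[of "1 / real k" k] by (simp add: field_simps)

lemma power_two_le: "0 < k \<Longrightarrow> 2 ^ l \<le> (1 + 1 / real k) ^ (k * l)"
  using power_mono[OF Bernoulli_two, of k l] by (simp add: power_mult)

text \<open>Rank \<open>0\<close> is a block of its own and takes the extra step; growth is
  geometric only from rank \<open>1\<close> on.\<close>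

lemma next_block_growth:
  assumes "0 < k" and "n \<le> 2 ^ l"
  shows "n \<le> (next_block k ^^ (1 + k * l)) 0"
proof -
  have step: "real m * (1 + 1 / real k) \<le> real (next_block k m)" for m
  proof -
    have "m < (m div k + 1) * k" using dividend_less_div_times[OF assms(1), of m] by (simp add: algebra_simps)
    then have "real m < real (m div k + 1) * real k" by (metis of_nat_less_iff of_nat_mult)
    then have "real m / real k \<le> real (m div k + 1)" using assms(1) by (simp add: divide_le_eq)
    then show ?thesis by (simp add: next_block_def algebra_simps)
  qed
  have "(1 + 1 / real k) ^ j \<le> real ((next_block k ^^ j) 1)" for j
  proof (induction j)
    case (Suc j)
    have "(1 + 1 / real k) ^ Suc j \<le> real ((next_block k ^^ j) 1) * (1 + 1 / real k)"
      using Suc.IH mult_right_mono[OF Suc.IH, of "1 + 1 / real k"] by (simp add: mult_ac)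
    also have "\<dots> \<le> real (next_block k ((next_block k ^^ j) 1))" by (rule step)
    finally show ?case by simp
  qed simp
  from this[of "k * l"] have "(2::real) ^ l \<le> real ((next_block k ^^ (k * l)) 1)"
    using power_two_le[OF assms(1), of l] by linarith
  moreover have "real n \<le> 2 ^ l" using assms(2) of_nat_le_iff[of n "2 ^ l", where 'a = real] by simp
  ultimately have "n \<le> (next_block k ^^ (k * l)) 1" by linarith
  moreover have "(next_block k ^^ (1 + k * l)) 0 = (next_block k ^^ (k * l)) (next_block k 0)"
    by (simp only: plus_1_eq_Suc funpow_Suc_right comp_apply)
  ultimately show ?thesis by (simp add: next_block_def)
qed

text \<open>The first \<open>k * k\<close> steps gain \<open>2 ^ k\<close>, more than the factor
  \<open>k\<close>; the other \<open>k * l\<close> gain the factor \<open>n\<close>. Rounding down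
  only helps.\<close>

lemma lower_decay:
  assumes "0 < k" and "0 < n" and "n \<le> 2 ^ l" and "0 \<le> M"
  shows "real_of_int ((lower k ^^ (k * k + k * l)) M) \<le> real_of_int M / (real k * real n)"
proof -
  have step: "real_of_int (lower k t) * (1 + 1 / real k) \<le> real_of_int t" for t
  proof -
    have "real_of_int (lower k t) \<le> real_of_int (t * int k) / real_of_int (int k + 1)"
      unfolding lower_def by (rule real_of_int_div4)
    then show ?thesis using assms(1) by (simp add: field_simps)
  qed
  have "real_of_int ((lower k ^^ j) M) * (1 + 1 / real k) ^ j \<le> real_of_int M" for j
  proof (induction j)
    case (Suc j)
    have "real_of_int (lower k ((lower k ^^ j) M)) * (1 + 1 / real k) * (1 + 1 / real k) ^ j
      \<le> real_of_int ((lower k ^^ j) M) * (1 + 1 / real k) ^ j"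
      by (intro mult_right_mono step) simp
    with Suc.IH show ?case by (simp add: mult_ac)
  qed simp
  from this[of "k * k + k * l"]
  have 1: "real_of_int ((lower k ^^ (k * k + k * l)) M) * (1 + 1 / real k) ^ (k * (k + l)) \<le> real_of_int M"
    by (simp add: algebra_simps)
  have "real k * real n \<le> 2 ^ k * 2 ^ l"
  proof (rule mult_mono)
    show "real k \<le> 2 ^ k" using of_nat_less_two_power[of k, where 'a = real] by simp
    show "real n \<le> 2 ^ l" using assms(3) of_nat_le_iff[of n "2 ^ l", where 'a = real] by simp
  qed auto
  also have "\<dots> \<le> (1 + 1 / real k) ^ (k * (k + l))"
    using power_two_le[OF assms(1), of "k + l"] by (simp add: power_add)
  finally have 2: "real k * real n \<le> (1 + 1 / real k) ^ (k * (k + l))" .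
  let ?t = "real_of_int ((lower k ^^ (k * k + k * l)) M)"
  have "?t * (real k * real n) \<le> real_of_int M"
  proof (cases "0 \<le> ?t")
    case True
    from mult_left_mono[OF 2 True] 1 show ?thesis by linarith
  next
    case False
    then have "?t * (real k * real n) \<le> 0" by (intro mult_nonpos_nonneg) auto
    with assms(4) show ?thesis by simp
  qed
  then show ?thesis using assms(1,2) by (simp add: le_divide_eq)
qed

lemma threshold_frozen:
  "i < m \<Longrightarrow> fold (threshold_step k i) bs (Node (Atom t) (Atom m)) = Node (Atom t) (Atom m)"
  by (induction bs) auto

text \<open>The string is built greedily: if \<open>t\<close> is close enough to \<open>x m\<close>,
  the block starting at \<open>m\<close> gets it, otherwise \<open>t\<close> is lowered.
  \<open>L\<close> and \<open>K\<close> limit the blocks and lowerings still to come, and each bit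
  uses up one of them. One string serves all ranks \<open>i\<close>, since the runs for different
  \<open>i\<close> agree until they freeze.\<close>

lemma good_bits:
  assumes k: "0 < k" and mono: "\<And>i j. i \<le> j \<Longrightarrow> j < n \<Longrightarrow> x j \<le> x i"
    and nonneg: "\<And>i. i < n \<Longrightarrow> 0 \<le> x i"
    and "n \<le> (next_block k ^^ L) m" and "real_of_int ((lower k ^^ K) t) \<le> real_of_int (x 0) / (real k * real n)"
    and "L + K \<le> B" and "m < n \<Longrightarrow> x m \<le> t"
  shows "\<exists>bs. length bs = B \<and> set bs \<subseteq> {Atom 0, Atom 1} \<and> (\<forall>i. m \<le> i \<and> i < n \<longrightarrow>
    good_threshold k n x i (dint (dfst (fold (threshold_step k (int i)) bs (Node (Atom t) (Atom (int m)))))))"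
  using assms(4-)
proof (induction B arbitrary: L K m t)
  case 0
  then show ?case by (intro exI[of _ "[]"]) auto
next
  case (Suc B)
  let ?e = "real_of_int (x 0) / (real k * real n)"
  show ?case
  proof (cases "m < n")
    case False
    \<comment> \<open>All ranks are covered; the string is merely padded to the prescribed
      length.\<close>
    then show ?thesis by (intro exI[of _ "replicate (Suc B) (Atom 0)"]) auto
  next
    case True
    from Suc.prems(1) True obtain L' where L: "L = Suc L'" by (cases L) auto
    have xt: "x m \<le> t" using Suc.prems(4) True by simp
    show ?thesis
    proof (cases "real_of_int t \<le> (1 + 1 / real k) * real_of_int (x m) + ?e")
      case close: True
      let ?m = "next_block k m"
      have "n \<le> (next_block k ^^ L') ?m" using Suc.prems(1) by (simp add: L funpow_swap1)
      moreover have "L' + K \<le> B" using Suc.prems(3) L by simp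
      moreover have "x ?m \<le> t" if "?m < n" using mono[of m ?m] that xt by (simp add: next_block_def)
      ultimately obtain bs where bs: "length bs = B" "set bs \<subseteq> {Atom 0, Atom 1}"
        "\<And>i. ?m \<le> i \<Longrightarrow> i < n \<Longrightarrow> good_threshold k n x i
          (dint (dfst (fold (threshold_step k (int i)) bs (Node (Atom t) (Atom (int ?m))))))"
        using Suc.IH[of L' ?m K t] Suc.prems(2) by blast
      have "good_threshold k n x i
          (dint (dfst (fold (threshold_step k (int i)) (Atom 1 # bs) (Node (Atom t) (Atom (int m))))))"
        if i: "m \<le> i" "i < n" for i
      proof -
        have first: "fold (threshold_step k (int i)) (Atom 1 # bs) (Node (Atom t) (Atom (int m))) =
            fold (threshold_step k (int i)) bs (Node (Atom t) (Atom (int ?m)))"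
          using i by (simp add: next_block_def zdiv_int algebra_simps)
        show ?thesis
        proof (cases "?m \<le> i")
          case True
          with bs(3) i first show ?thesis by simp
        next
          case False
          then have "good_threshold k n x i t"
            unfolding good_threshold_def using i xt close by (intro exI[of _ m]) (auto simp: next_block_def)
          then show ?thesis using first False threshold_frozen[of "int i" "int ?m"] by simp
        qed
      qed
      with bs(1,2) show ?thesis by (intro exI[of _ "Atom 1 # bs"]) auto
    next
      case far: False
      \<comment> \<open>At the bottom of the grid \<open>t\<close> is at most the additive slack and
        therefore never too far from \<open>x m\<close>.\<close>
      have "K \<noteq> 0"
      proof
        assume "K = 0"
        with Suc.prems(2) have "real_of_int t \<le> ?e" by simp
        moreover have "0 \<le> (1 + 1 / real k) * real_of_int (x m)" using nonneg[OF True] by simp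
        ultimately show False using far by simp
      qed
      then obtain K' where K: "K = Suc K'" by (cases K) auto
      have "0 \<le> ?e" using nonneg[of 0] True by simp
      with far have "(1 + 1 / real k) * real_of_int (x m) < real_of_int t" by linarith
      then have "real_of_int (x m * (int k + 1)) < real_of_int (t * int k)" using k by (simp add: field_simps)
      \<comment> \<open>As \<open>t\<close> exceeds \<open>x m\<close> by more than the factor 1 +
        1/k, it stays above after one lowering; rounding down does no harm because
        \<open>x m\<close> is an integer.\<close>
      then have "x m * (int k + 1) \<le> t * int k" by linarith
      then have "x m * (int k + 1) div (int k + 1) \<le> t * int k div (int k + 1)" by (intro zdiv_mono1) auto
      then have "x m \<le> lower k t" by (simp add: lower_def)
      moreover have "real_of_int ((lower k ^^ K') (lower k t)) \<le> ?e"
        using Suc.prems(2) by (simp add: K funpow_swap1)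
      moreover have "L + K' \<le> B" using Suc.prems(3) K by simp
      ultimately obtain bs where bs: "length bs = B" "set bs \<subseteq> {Atom 0, Atom 1}"
        "\<And>i. m \<le> i \<Longrightarrow> i < n \<Longrightarrow> good_threshold k n x i
          (dint (dfst (fold (threshold_step k (int i)) bs (Node (Atom (lower k t)) (Atom (int m))))))"
        using Suc.IH[of L m K' "lower k t"] Suc.prems(1) by blast
      then show ?thesis by (intro exI[of _ "Atom 0 # bs"]) (auto simp: lower_def)
    qed
  qed
qed

text \<open>Starts at rank \<open>0\<close> with the exact maximum. The \<open>1 + k * l\<close>
  blocks and \<open>k * k + k * l\<close> lowerings add up to the number of bits.\<close>

lemma good_guess:
  assumes "0 < k" and "0 < n" and "\<And>i j. i \<le> j \<Longrightarrow> j < n \<Longrightarrow> x j \<le> x i"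
    and "\<And>i. i < n \<Longrightarrow> 0 \<le> x i" and "n \<le> 2 ^ l"
  shows "\<exists>bs. length bs = k * k + 1 + 2 * k * l \<and> set bs \<subseteq> {Atom 0, Atom 1} \<and>
    (\<forall>i<n. good_threshold k n x i (threshold k (Node (Atom (x 0)) (enc_list bs)) (int i)))"
proof -
  have le: "1 + k * l + (k * k + k * l) \<le> k * k + 1 + 2 * k * l" by simp
  have "\<exists>bs. length bs = k * k + 1 + 2 * k * l \<and> set bs \<subseteq> {Atom 0, Atom 1} \<and> (\<forall>i. 0 \<le> i \<and> i < n \<longrightarrow>
    good_threshold k n x i (dint (dfst (fold (threshold_step k (int i)) bs (Node (Atom (x 0)) (Atom (int 0)))))))"
    by (rule good_bits[where L = "1 + k * l" and K = "k * k + k * l", OF assms(1)])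
      (use assms(3,4) next_block_growth[OF assms(1,5)] lower_decay[OF assms(1,2,5) assms(4)[OF assms(2)]] le
        in simp_all)
  then show ?thesis by (simp add: threshold_def)
qed

section \<open>Contents of the list of guesses\<close>

lemma items_double:
  "set (items (double G)) =
    (\<lambda>g. Node (dfst g) (Node (Atom 0) (dsnd g))) ` set (items G) \<union>
    (\<lambda>g. Node (dfst g) (Node (Atom 1) (dsnd g))) ` set (items G)"
proof -
  have "set (items (fold (\<lambda>g acc. Node (Node (dfst g) (Node (Atom 0) (dsnd g)))
      (Node (Node (dfst g) (Node (Atom 1) (dsnd g))) acc)) gs acc)) =
    (\<lambda>g. Node (dfst g) (Node (Atom 0) (dsnd g))) ` set gs \<union>
    (\<lambda>g. Node (dfst g) (Node (Atom 1) (dsnd g))) ` set gs \<union> set (items acc)" for gs acc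
    by (induction gs arbitrary: acc) auto
  then show ?thesis by (simp add: double_def)
qed

lemma items_double_funpow_fst: "g \<in> set (items ((double ^^ m) G)) \<Longrightarrow> dfst g \<in> dfst ` set (items G)"
  by (induction m arbitrary: g) (auto simp: items_double)

lemma items_double_funpow:
  assumes "Node M b \<in> set (items G)" and "set bs \<subseteq> {Atom 0, Atom 1}"
  shows "Node M (foldr Node bs b) \<in> set (items ((double ^^ length bs) G))"
  using assms(2)
proof (induction bs)
  case (Cons c bs)
  then have "Node M (foldr Node bs b) \<in> set (items ((double ^^ length bs) G))" by simp
  then have "Node M (Node c (foldr Node bs b)) \<in> set (items (double ((double ^^ length bs) G)))"
    using Cons.prems unfolding items_double by (auto intro: rev_image_eqI)
  then show ?case by simp
qed (simp add: assms(1))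

lemma enc_list_eq_foldr: "enc_list bs = foldr Node bs (Atom 0)"
  by (induction bs) auto

lemma guesses_eq_funpow:
  "guesses k I = (double ^^ length (items (bit_count k I)))
    (Node (Node (Atom 0) (Atom 0)) (enc_list (rev (map (\<lambda>y. Node (dsnd y) (Atom 0)) (items I)))))"
proof -
  have "fold (\<lambda>_. double) ys G = (double ^^ length ys) G" for ys :: "data list" and G
    by (induction ys arbitrary: G) (simp_all add: funpow_swap1)
  then show ?thesis by (simp add: guesses_def)
qed

lemma guesses_nonempty: "items (guesses k I) \<noteq> []"
proof -
  have "items G \<noteq> [] \<Longrightarrow> set (items ((double ^^ m) G)) \<noteq> {}" for m G
    by (induction m) (simp_all add: items_double)
  then show ?thesis by (simp add: guesses_eq_funpow)
qed

lemma guesses_first: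
  "g \<in> set (items (guesses k I)) \<Longrightarrow> dfst g = Atom 0 \<or> dfst g \<in> dsnd ` set (items I)"
  unfolding guesses_eq_funpow by (drule items_double_funpow_fst) auto

lemma guesses_complete:
  assumes "M = Atom 0 \<or> M \<in> dsnd ` set (items I)" and "set bs \<subseteq> {Atom 0, Atom 1}"
    and "length bs = length (items (bit_count k I))"
  shows "Node M (enc_list bs) \<in> set (items (guesses k I))"
  unfolding guesses_eq_funpow enc_list_eq_foldr[of bs] assms(3)[symmetric]
  using assms(1) by (intro items_double_funpow assms(2)) auto

section \<open>Correctness\<close>

lemma spine_enc_list: "spine (enc_list xs) = map (\<lambda>i. enc_list (drop i xs)) [0..<length xs]"
proof (induction xs)
  case (Cons x xs)
  have "[0..<length (x # xs)] = 0 # map Suc [0..<length xs]" by (simp add: map_Suc_upt upt_conv_Cons del: upt_Suc)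
  with Cons show ?case by (simp del: upt_Suc)
qed simp

lemma scaled_enc_rat:
  assumes "dint (dsnd (enc_rat r)) dvd q"
  shows "rat_of_int (scaled q (enc_rat r)) = of_int q * r"
proof -
  obtain a b where ab: "quotient_of r = (a, b)" by (cases "quotient_of r")
  have b: "b > 0" using quotient_of_denom_pos[OF ab] .
  from assms obtain m where m: "q = b * m" by (auto simp: enc_rat_def ab)
  have "scaled q (enc_rat r) = a * m" using b by (simp add: enc_rat_def ab scaled_def m)
  then show ?thesis using b by (simp add: m quotient_of_div[OF ab])
qed

lemma enc_rat_den_pos: "0 < dint (dsnd (enc_rat r))"
  using quotient_of_denom_pos[of r] by (cases "quotient_of r") (auto simp: enc_rat_def)

lemma enc_rat_of_int: "enc_rat (of_int z) = Node (Atom z) (Atom 1)"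
  by (simp add: enc_rat_def)

lemma prod_list_pos_int: "(\<And>x. x \<in> set xs \<Longrightarrow> 0 < f x) \<Longrightarrow> 0 < (\<Prod>x\<leftarrow>xs. f x :: int)"
  by (induction xs) auto

lemma dvd_prod_list_map: "x \<in> set xs \<Longrightarrow> f x dvd (\<Prod>x\<leftarrow>xs. f x :: int)"
  by (induction xs) auto

lemma sum_list_rev_map_upt: "(\<Sum>d\<leftarrow>rev (map f [0..<n]). g d) = (\<Sum>i<n. g (f i))"
  by (simp add: rev_map[symmetric] interv_sum_list_conv_sum_set_nat comp_def atLeast0LessThan)

lemma fold_better_minimal:
  assumes "gs \<noteq> []"
  shows "\<exists>g\<in>set gs. fold (better k f env) gs (Atom 0) = candidate k f env g \<and>
    (\<forall>g'\<in>set gs. dint (dfst (candidate k f env g)) \<le> dint (dfst (candidate k f env g')))"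
  using assms
proof (induction gs rule: rev_nonempty_induct)
  case (single g)
  then show ?case by (simp add: better_def)
next
  case (snoc h gs)
  then obtain g where g: "g \<in> set gs" "fold (better k f env) gs (Atom 0) = candidate k f env g"
    "\<And>g'. g' \<in> set gs \<Longrightarrow> dint (dfst (candidate k f env g)) \<le> dint (dfst (candidate k f env g'))" by blast
  have node: "is_node (candidate k f env g)" by (simp add: candidate_def)
  show ?case
  proof (cases "dint (dfst (candidate k f env h)) < dint (dfst (candidate k f env g))")
    case True
    then have "fold (better k f env) (gs @ [h]) (Atom 0) = candidate k f env h" by (simp add: g(2) better_def)
    moreover have "\<forall>g'\<in>set (gs @ [h]). dint (dfst (candidate k f env h)) \<le> dint (dfst (candidate k f env g'))"
      using True g(3) by fastforce
    ultimately show ?thesis by auto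
  next
    case False
    then have "fold (better k f env) (gs @ [h]) (Atom 0) = candidate k f env g"
      using node by (simp add: g(2) better_def)
    with False g(1,3) show ?thesis by fastforce
  qed
qed

text \<open>Determinism turns the given program into a function, which can be plugged into
  \<open>ordered_alg\<close>. Its value is meaningful only where the program halts.\<close>

definition output_of :: "com \<Rightarrow> data \<Rightarrow> data" where
  "output_of c inp = (THE out. \<exists>t. computes c inp t out)"

lemma output_of_eq: "computes c inp t out \<Longrightarrow> output_of c inp = out"
  unfolding output_of_def using computes_deterministic by blast

definition min_sum_input :: "comb_problem \<Rightarrow> data \<Rightarrow> data list \<Rightarrow> (data \<Rightarrow> rat) \<Rightarrow> bool" where
  "min_sum_input P x us v \<longleftrightarrow> x \<in> instances P \<and> distinct us \<and> set us = ground P x \<and>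
    (\<forall>e\<in>ground P x. 0 \<le> v e)"

lemma polytime_approx_min_sumD:
  assumes "polytime_approx a (min_sum_problem P) c"
  shows "\<exists>p. \<forall>x us v. min_sum_input P x us v \<longrightarrow>
    (\<exists>t. computes c (Node x (enc_values us v)) t (output_of c (Node x (enc_values us v))) \<and>
      t \<le> poly p (dsize (Node x (enc_values us v))))"
    and "min_sum_input P x us v \<Longrightarrow> feasible P x \<noteq> {} \<Longrightarrow>
    \<exists>S\<in>feasible P x. encodes_set (output_of c (Node x (enc_values us v))) S \<and>
      real_of_rat (\<Sum>e\<in>S. v e) \<le> a * real_of_rat (Min ((\<lambda>S. \<Sum>e\<in>S. v e) ` feasible P x))"
proof -
  from assms obtain p :: "nat poly" where p: "\<forall>(inp, F, cost) \<in> min_sum_problem P. \<exists>t out.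
      computes c inp t out \<and> t \<le> poly p (dsize inp) \<and>
      (F \<noteq> {} \<longrightarrow>
        (\<exists>S\<in>F. encodes_set out S \<and> real_of_rat (cost S) \<le> a * real_of_rat (Min (cost ` F))))"
    unfolding polytime_approx_def by blast
  have *: "\<exists>t. computes c (Node x (enc_values us v)) t (output_of c (Node x (enc_values us v))) \<and>
      t \<le> poly p (dsize (Node x (enc_values us v))) \<and>
      (feasible P x \<noteq> {} \<longrightarrow> (\<exists>S\<in>feasible P x. encodes_set (output_of c (Node x (enc_values us v))) S \<and>
        real_of_rat (\<Sum>e\<in>S. v e) \<le> a * real_of_rat (Min ((\<lambda>S. \<Sum>e\<in>S. v e) ` feasible P x))))"
    if "min_sum_input P x us v" for x us v
  proof -
    let ?inp = "Node x (enc_values us v)"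
    have "(?inp, feasible P x, \<lambda>S. \<Sum>e\<in>S. v e) \<in> min_sum_problem P"
      using that unfolding min_sum_input_def min_sum_problem_def by blast
    with p obtain t out where t: "computes c ?inp t out" "t \<le> poly p (dsize ?inp)"
      "feasible P x \<noteq> {} \<longrightarrow> (\<exists>S\<in>feasible P x. encodes_set out S \<and>
        real_of_rat (\<Sum>e\<in>S. v e) \<le> a * real_of_rat (Min ((\<lambda>S. \<Sum>e\<in>S. v e) ` feasible P x)))"
      by fastforce
    then show ?thesis unfolding output_of_eq[OF t(1)] by blast
  qed
  from * show "\<exists>p. \<forall>x us v. min_sum_input P x us v \<longrightarrow>
    (\<exists>t. computes c (Node x (enc_values us v)) t (output_of c (Node x (enc_values us v))) \<and>
      t \<le> poly p (dsize (Node x (enc_values us v))))" by blast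
  show "\<exists>S\<in>feasible P x. encodes_set (output_of c (Node x (enc_values us v))) S \<and>
      real_of_rat (\<Sum>e\<in>S. v e) \<le> a * real_of_rat (Min ((\<lambda>S. \<Sum>e\<in>S. v e) ` feasible P x))"
    if "min_sum_input P x us v" "feasible P x \<noteq> {}"
    using *[OF that(1)] that(2) by blast
qed

text \<open>With \<open>d = 1 / k\<close>, the left side is \<open>1 + 3 * d + d * d\<close>, at
  most \<open>1 + 4 * d\<close> because \<open>d \<le> 1\<close>; hence the
  \<open>4\<close>.\<close>

lemma approx_factor:
  assumes "0 < e" and "4 / e \<le> real k" and "0 < k"
  shows "(1 + 1 / real k)\<^sup>2 + 1 / real k \<le> 1 + e"
proof -
  have "1 / real k \<le> e / 4" using assms by (simp add: field_simps)
  moreover have "(1 / real k) * (1 / real k) \<le> 1 * (1 / real k)" using assms(3) by (intro mult_right_mono) auto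
  moreover have "(1 + 1 / real k)\<^sup>2 = 1 + 2 * (1 / real k) + (1 / real k) * (1 / real k)"
    by (simp only: power2_eq_square) (simp add: algebra_simps)
  ultimately show ?thesis by linarith
qed

section \<open>A fixed instance with integral values, weights and drops\<close>

locale ordered_instance =
  fixes us :: "data list" and v :: "data \<Rightarrow> rat" and w :: "rat list" and k :: nat
  assumes distinct_us: "distinct us" and v_nonneg: "\<And>e. e \<in> set us \<Longrightarrow> 0 \<le> v e"
    and weights: "weight_vector (length us) w" and k_pos: "0 < k"
begin

abbreviation "n \<equiv> length us"

definition "V = enc_values us v"
definition "W = enc_list (map enc_rat w)"
definition "u e = scaled (value_den V) (enc_rat (v e))"
text \<open>The padding by \<open>0\<close> lets the drops \<open>c i, ..., c (n - 1)\<close>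
  telescope to \<open>ws i\<close>.\<close>

definition "ws i = (if i < n then scaled (weight_den W) (enc_rat (w ! i)) else 0)"
definition "c i = ws i - ws (Suc i)"
definition "I = int_values V"
definition "C = weight_drops W"

definition "scale = rat_of_int (value_den V) * rat_of_int (weight_den W)"
definition "norm_of S = ord_norm (set us) w (restrict_vec v S)"
definition "bound g S = offset k C g + (\<Sum>e\<in>S. penalty k C g (u e))"

lemma length_w: "length w = n" and w_mono: "i \<le> j \<Longrightarrow> j < n \<Longrightarrow> w ! j \<le> w ! i"
  and w_nonneg: "i < n \<Longrightarrow> 0 \<le> w ! i"
  using weights sorted_wrt_nth_less[of "(\<ge>)" w i j] unfolding weight_vector_def
  by (auto simp: le_less)

lemma items_V: "items V = map (\<lambda>e. Node e (enc_rat (v e))) us"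
  by (simp add: V_def enc_values_def)

lemma value_den_pos: "0 < value_den V"
  unfolding value_den_def items_V by (rule prod_list_pos_int) (auto simp: enc_rat_den_pos)

lemma weight_den_pos: "0 < weight_den W"
  unfolding weight_den_def W_def by (rule prod_list_pos_int) (auto simp: enc_rat_den_pos)

lemma scale_pos: "0 < scale"
  using value_den_pos weight_den_pos by (simp add: scale_def)

lemma of_int_u: "e \<in> set us \<Longrightarrow> rat_of_int (u e) = of_int (value_den V) * v e"
  unfolding u_def value_den_def items_V
  by (rule scaled_enc_rat) (use dvd_prod_list_map[of e us "\<lambda>e. dint (dsnd (enc_rat (v e)))"] in \<open>simp add: comp_def\<close>)

lemma u_nonneg: "e \<in> set us \<Longrightarrow> 0 \<le> u e"
  using of_int_u[of e] v_nonneg[of e] value_den_pos by (metis less_imp_le mult_nonneg_nonneg of_int_0_le_iff)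

lemma of_int_ws: "i < n \<Longrightarrow> rat_of_int (ws i) = of_int (weight_den W) * w ! i"
  using dvd_prod_list_map[of "w ! i" w "\<lambda>r. dint (dsnd (enc_rat r))"] length_w
  by (simp add: ws_def scaled_enc_rat weight_den_def W_def comp_def)

text \<open>The last drop is the last weight itself, so nonnegative weights are used there and
  monotonicity before.\<close>

lemma c_nonneg: "0 \<le> c i"
proof (cases "i < n")
  case True
  have "rat_of_int (ws (Suc i)) \<le> rat_of_int (ws i)"
  proof (cases "Suc i < n")
    case True
    then show ?thesis using w_mono[of i "Suc i"] weight_den_pos by (simp add: of_int_ws)
  next
    case False
    then show ?thesis using \<open>i < n\<close> w_nonneg[of i] weight_den_pos by (simp add: of_int_ws ws_def[of "Suc i"])
  qed
  then show ?thesis by (simp add: c_def)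
qed (simp add: c_def ws_def)

lemma sum_c: "i \<le> n \<Longrightarrow> (\<Sum>j=i..<n. c j) = ws i"
  using sum_Suc_diff'[of i n "\<lambda>j. - ws j"] by (simp add: c_def ws_def[of n])

lemma items_I: "items I = rev (map (\<lambda>e. Node e (Atom (u e))) us)"
  by (simp add: I_def int_values_def items_V u_def comp_def)

text \<open>The suffix that begins at index \<open>i\<close> has length \<open>n - i\<close>, which
  is how the program recovers its rank.\<close>

lemma items_C: "items C = rev (map (\<lambda>i. Node (Atom (int i + 1)) (Atom (c i))) [0..<n])"
proof -
  have "Node (Atom (int (length (items W)) - int (length (items y)) + 1))
      (Atom (scaled (weight_den W) (dfst y) - scaled (weight_den W) (dfst (dsnd y)))) =
    Node (Atom (int i + 1)) (Atom (c i))"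
    if i: "i < n" and y: "y = enc_list (drop i (map enc_rat w))" for i y
  proof -
    have "drop i w = w ! i # drop (Suc i) w" using i length_w by (simp add: Cons_nth_drop_Suc)
    then have "y = Node (enc_rat (w ! i)) (enc_list (drop (Suc i) (map enc_rat w)))"
      by (simp add: y drop_map)
    moreover have "scaled (weight_den W) (dfst (enc_list (drop (Suc i) (map enc_rat w)))) = ws (Suc i)"
    proof (cases "Suc i < n")
      case True
      then have "drop (Suc i) w = w ! Suc i # drop (Suc (Suc i)) w" using length_w by (simp add: Cons_nth_drop_Suc)
      with True show ?thesis by (simp add: drop_map ws_def)
    qed (use length_w in \<open>simp add: ws_def scaled_def\<close>)
    moreover have "length (items W) = n" using length_w by (simp add: W_def)
    moreover have "length (items y) = n - i" using length_w by (simp add: y)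
    ultimately show ?thesis using i by (simp add: c_def ws_def[of i])
  qed
  then show ?thesis
    unfolding C_def weight_drops_def
    by (simp add: W_def spine_enc_list length_w del: enc_list.simps)
qed

lemma penalty_eq: "penalty k C g z = (\<Sum>i<n. c i * max 0 (z - threshold k g (int i)))"
  unfolding penalty_def items_C sum_list_rev_map_upt by simp

lemma offset_eq: "offset k C g = (\<Sum>i<n. c i * ((int i + 1) * threshold k g (int i)))"
  unfolding offset_def items_C sum_list_rev_map_upt by simp

lemma penalty_nonneg: "0 \<le> penalty k C g z"
  unfolding penalty_eq by (intro sum_nonneg mult_nonneg_nonneg c_nonneg) simp

text \<open>The reversals in \<open>int_values\<close> and \<open>penalties\<close> cancel, so the
  query lists the ground set in the original order.\<close>

lemma penalties_eq: "penalties k C g I = enc_values us (\<lambda>e. of_int (penalty k C g (u e)))"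
  by (simp add: penalties_def items_I enc_values_def enc_rat_of_int rev_map comp_def)

lemma lookup_eq: "e \<in> set us \<Longrightarrow> lookup (penalties k C g I) e = penalty k C g (u e)"
  by (simp add: penalties_eq lookup_def enc_values_def enc_rat_of_int comp_def
      sum_list_distinct_conv_sum_set[OF distinct_us])

lemma guess_nonneg: "g \<in> set (items (guesses k I)) \<Longrightarrow> 0 \<le> dint (dfst g)"
  using guesses_first[of g k I] u_nonneg by (auto simp: items_I)

lemma threshold_nonneg: "0 \<le> dint (dfst g) \<Longrightarrow> 0 \<le> threshold k g i"
  using threshold_invariant[OF k_pos, of i "items (dsnd g)" "dint (dfst g)"] by (auto simp: threshold_def)

lemma offset_nonneg: "0 \<le> dint (dfst g) \<Longrightarrow> 0 \<le> offset k C g"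
  unfolding offset_eq by (intro sum_nonneg mult_nonneg_nonneg c_nonneg threshold_nonneg) simp_all

text \<open>\<open>x\<close> is the sorted integral vector of \<open>S\<close>, with a
  \<open>0\<close> for each element outside \<open>S\<close>. The clause on \<open>f\<close> says
  that, apart from zeros, \<open>x\<close> and the values in \<open>S\<close> form the same
  multiset; hence the restriction to \<open>f 0 = 0\<close>.\<close>

definition ranks :: "data set \<Rightarrow> (nat \<Rightarrow> int) \<Rightarrow> bool" where
  "ranks S x \<longleftrightarrow> (\<forall>i j. i \<le> j \<longrightarrow> j < n \<longrightarrow> x j \<le> x i) \<and> (\<forall>i<n. 0 \<le> x i) \<and>
    rat_of_int (\<Sum>i<n. ws i * x i) = scale * norm_of S \<and>
    (\<forall>f :: int \<Rightarrow> int. f 0 = 0 \<longrightarrow> (\<Sum>i<n. f (x i)) = (\<Sum>e\<in>S. f (u e))) \<and>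
    (0 < n \<longrightarrow> x 0 = 0 \<or> x 0 \<in> u ` set us)"

lemma ex_ranks:
  assumes S: "S \<subseteq> set us"
  shows "\<exists>x. ranks S x"
proof -
  define a where "a = abs_desc (set us) (restrict_vec v S)"
  define z where "z e = (if e \<in> S then u e else 0)" for e
  \<comment> \<open>Nothing is rounded for \<open>i < n\<close>: \<open>value_den V\<close> is a
    multiple of all denominators, so the floor only changes the type.\<close>
  define x where "x i = \<lfloor>of_int (value_den V) * a ! i\<rfloor>" for i
  have mset_a: "mset a = image_mset (\<lambda>e. \<bar>restrict_vec v S e\<bar>) (mset_set (set us))"
    by (simp add: a_def abs_desc_def)
  have len: "length a = n"
    using mset_a distinct_card[OF distinct_us] by (metis size_image_mset size_mset size_mset_set)
  have sorted: "a ! j \<le> a ! i" if "i \<le> j" "j < n" for i j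
  proof -
    have "sorted (rev a)" by (simp add: a_def abs_desc_def)
    with that len show ?thesis by (simp add: sorted_rev_iff_nth_mono)
  qed
  have z: "of_int (value_den V) * \<bar>restrict_vec v S e\<bar> = rat_of_int (z e)" if "e \<in> set us" for e
    using that v_nonneg[OF that] by (simp add: restrict_vec_def z_def of_int_u)
  have mset_z: "image_mset (\<lambda>r. \<lfloor>of_int (value_den V) * r\<rfloor>) (mset a) = image_mset z (mset_set (set us))"
    unfolding mset_a by (auto simp: z image_mset.compositionality comp_def intro!: image_mset_cong)
  have x_in: "x i \<in> z ` set us" and x_eq: "rat_of_int (x i) = of_int (value_den V) * a ! i" if "i < n" for i
  proof -
    have "a ! i \<in># mset a" using that len by simp
    then obtain e where e: "e \<in> set us" "a ! i = \<bar>restrict_vec v S e\<bar>" unfolding mset_a by auto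
    have "of_int (value_den V) * a ! i = rat_of_int (z e)" using z[OF e(1)] by (simp add: e(2))
    then show "rat_of_int (x i) = of_int (value_den V) * a ! i" "x i \<in> z ` set us"
      using e(1) by (simp_all add: x_def)
  qed
  have "ranks S x"
    unfolding ranks_def
  proof (intro conjI)
    show "\<forall>i j. i \<le> j \<longrightarrow> j < n \<longrightarrow> x j \<le> x i"
      using sorted value_den_pos by (auto simp: x_def intro!: floor_mono mult_left_mono)
    show "\<forall>i<n. 0 \<le> x i" using x_in u_nonneg by (fastforce simp: z_def)
    show "rat_of_int (\<Sum>i<n. ws i * x i) = scale * norm_of S"
      using distinct_card[OF distinct_us]
      by (simp add: norm_of_def ord_norm_def scale_def sum_distrib_left of_int_ws x_eq a_def[symmetric] mult_ac)
    show "\<forall>f :: int \<Rightarrow> int. f 0 = 0 \<longrightarrow> (\<Sum>i<n. f (x i)) = (\<Sum>e\<in>S. f (u e))"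
    proof (intro allI impI)
      fix f :: "int \<Rightarrow> int"
      assume f0: "f 0 = 0"
      have "(\<Sum>i<n. f (x i)) = (\<Sum>r\<leftarrow>a. f \<lfloor>of_int (value_den V) * r\<rfloor>)"
        by (simp add: x_def sum_list_sum_nth len atLeast0LessThan)
      also have "\<dots> = \<Sum>\<^sub># (image_mset f (image_mset (\<lambda>r. \<lfloor>of_int (value_den V) * r\<rfloor>) (mset a)))"
        by (simp add: sum_mset_sum_list[symmetric] image_mset.compositionality comp_def)
      also have "\<dots> = (\<Sum>e\<in>set us. f (z e))"
        unfolding mset_z by (simp add: sum_unfold_sum_mset image_mset.compositionality comp_def)
      also have "\<dots> = (\<Sum>e\<in>S. f (z e))"
        using S f0 by (intro sum.mono_neutral_right) (auto simp: z_def)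
      finally show "(\<Sum>i<n. f (x i)) = (\<Sum>e\<in>S. f (u e))" by (simp add: z_def)
    qed
    show "0 < n \<longrightarrow> x 0 = 0 \<or> x 0 \<in> u ` set us" using x_in by (fastforce simp: z_def)
  qed
  then show ?thesis by blast
qed

text \<open>Thresholds are nonnegative, so \<open>penalty\<close> vanishes at \<open>0\<close> and
  the sum over \<open>S\<close> may be replaced by one over all ranks.\<close>

lemma bound_ranked:
  assumes "0 \<le> dint (dfst g)"
    and x: "ranks S x"
  shows "bound g S = (\<Sum>i<n. c i * ((int i + 1) * threshold k g (int i) +
    (\<Sum>j<n. max 0 (x j - threshold k g (int i)))))"
proof -
  have "penalty k C g 0 = 0" unfolding penalty_eq using threshold_nonneg[OF assms(1)] by simp
  then have "(\<Sum>e\<in>S. penalty k C g (u e)) = (\<Sum>j<n. penalty k C g (x j))"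
    using x unfolding ranks_def by (simp del: sum.lessThan_Suc)
  also have "\<dots> = (\<Sum>i<n. \<Sum>j<n. c i * max 0 (x j - threshold k g (int i)))"
    unfolding penalty_eq by (rule sum.swap)
  finally show ?thesis
    unfolding bound_def offset_eq distrib_left sum_distrib_left sum.distrib by simp
qed

lemma norm_by_drops: "(\<Sum>i<n. ws i * x i) = (\<Sum>i<n. c i * (\<Sum>j\<le>i. x j))"
proof -
  have "(\<Sum>i<n. ws i * x i) = (\<Sum>i<n. (\<Sum>j=i..<n. c j) * x i)"
    by (intro sum.cong refl) (simp add: sum_c)
  then show ?thesis unfolding weighted_sum_by_drops .
qed

lemma norm_le_bound:
  assumes "S \<subseteq> set us" and g: "0 \<le> dint (dfst g)"
  shows "scale * norm_of S \<le> of_int (bound g S)"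
proof -
  from ex_ranks[OF assms(1)] obtain x where x: "ranks S x" by blast
  have "(\<Sum>i<n. ws i * x i) \<le> bound g S"
    unfolding norm_by_drops bound_ranked[OF g x]
    by (intro sum_mono mult_left_mono top_sum_le_threshold c_nonneg) simp
  then have "rat_of_int (\<Sum>i<n. ws i * x i) \<le> of_int (bound g S)" by (simp only: of_int_le_iff)
  then show ?thesis using x unfolding ranks_def by simp
qed

lemma bound_le_norm:
  assumes "S \<subseteq> set us"
  shows "\<exists>g\<in>set (items (guesses k I)).
    real_of_int (bound g S) \<le> ((1 + 1 / real k)\<^sup>2 + 1 / real k) * real_of_rat (scale * norm_of S)"
proof -
  from ex_ranks[OF assms(1)] obtain x where x: "ranks S x" by blast
  then have mono: "\<And>i j. i \<le> j \<Longrightarrow> j < n \<Longrightarrow> x j \<le> x i" and nonneg: "\<And>i. i < n \<Longrightarrow> 0 \<le> x i"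
    and norm: "rat_of_int (\<Sum>i<n. ws i * x i) = scale * norm_of S"
    and x0: "0 < n \<Longrightarrow> x 0 = 0 \<or> x 0 \<in> u ` set us"
    unfolding ranks_def by blast+
  have "\<exists>g\<in>set (items (guesses k I)). \<forall>i<n. good_threshold k n x i (threshold k g (int i))"
  \<comment> \<open>Without ranks every guess is good; otherwise the maximum \<open>x 0\<close> is
    needed as the starting threshold.\<close>
  proof (cases "n = 0")
    case True
    then show ?thesis using guesses_nonempty[of k I] by (cases "items (guesses k I)") auto
  next
    case False
    have len: "length (items I) = n" by (simp add: items_I)
    obtain l where l: "length (items (bit_count k I)) = k * k + 1 + 2 * k * l" "n < 2 ^ l"
      using bit_count_length[of k I] unfolding len by blast
    have "0 < n" "n \<le> 2 ^ l" using False l(2) by auto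
    from good_guess[of k n x l, OF k_pos this(1) mono nonneg this(2)] obtain bs
      where bs: "length bs = k * k + 1 + 2 * k * l" "set bs \<subseteq> {Atom 0, Atom 1}"
        "\<forall>i<n. good_threshold k n x i (threshold k (Node (Atom (x 0)) (enc_list bs)) (int i))" by blast
    have "Atom (x 0) = Atom 0 \<or> Atom (x 0) \<in> dsnd ` set (items I)"
      using x0[OF \<open>0 < n\<close>] by (auto simp: items_I image_image)
    from guesses_complete[OF this bs(2)] bs(1,3) l(1) show ?thesis by auto
  qed
  then obtain g where g: "g \<in> set (items (guesses k I))"
    and good: "\<And>i. i < n \<Longrightarrow> good_threshold k n x i (threshold k g (int i))" by blast
  let ?B = "(1 + 1 / real k)\<^sup>2 + 1 / real k"
  have "real_of_int (bound g S) = (\<Sum>i<n. real_of_int (c i) * ((real i + 1) * real_of_int (threshold k g (int i)) +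
    (\<Sum>j<n. max 0 (real_of_int (x j) - real_of_int (threshold k g (int i))))))"
    by (simp add: bound_ranked[OF guess_nonneg[OF g] x] of_int_max)
  also have "\<dots> \<le> (\<Sum>i<n. real_of_int (c i) * (?B * (\<Sum>j\<le>i. real_of_int (x j))))"
    by (intro sum_mono mult_left_mono good_threshold_le_top_sum[where x = x, OF k_pos _ mono nonneg] good)
      (simp_all add: c_nonneg)
  also have "\<dots> = ?B * (\<Sum>i<n. real_of_int (c i) * (\<Sum>j\<le>i. real_of_int (x j)))"
    by (rule trans[OF _ sum_distrib_left[symmetric]]) (intro sum.cong refl mult.left_commute)
  also have "(\<Sum>i<n. real_of_int (c i) * (\<Sum>j\<le>i. real_of_int (x j))) = real_of_int (\<Sum>i<n. ws i * x i)"
    unfolding norm_by_drops by simp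
  also have "real_of_int (\<Sum>i<n. ws i * x i) = real_of_rat (scale * norm_of S)"
    unfolding norm[symmetric] by (simp only: of_rat_of_int_eq)
  finally show ?thesis using g by blast
qed

definition "inp x = Node x (Node V W)"

lemma query_eq: "query k (environment (inp x)) g = Node x (enc_values us (\<lambda>e. of_int (penalty k C g (u e))))"
proof -
  have "query k (environment (inp x)) g = Node x (penalties k C g I)"
    by (simp add: query_def environment_def inp_def I_def C_def)
  then show ?thesis by (simp only: penalties_eq)
qed

lemma candidate_value:
  assumes "encodes_set (f (query k (environment (inp x)) g)) S" and "S \<subseteq> set us"
  shows "dint (dfst (candidate k f (environment (inp x)) g)) = bound g S"
proof -
  from assms(1) obtain xs where xs: "distinct xs" "set xs = S" "f (query k (environment (inp x)) g) = enc_list xs"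
    unfolding encodes_set_def by blast
  have snd: "dsnd (query k (environment (inp x)) g) = penalties k C g I"
    by (simp add: query_eq penalties_eq)
  have "(\<Sum>e\<leftarrow>xs. lookup (penalties k C g I) e) = (\<Sum>e\<in>S. lookup (penalties k C g I) e)"
    using xs(1,2) by (simp add: sum_list_distinct_conv_sum_set)
  also have "\<dots> = (\<Sum>e\<in>S. penalty k C g (u e))"
    using assms(2) by (intro sum.cong refl lookup_eq) auto
  finally have "(\<Sum>e\<leftarrow>xs. lookup (penalties k C g I) e) = (\<Sum>e\<in>S. penalty k C g (u e))" .
  moreover have "dsnd (dsnd (environment (inp x))) = C" by (simp add: environment_def inp_def C_def)
  ultimately show ?thesis unfolding candidate_def snd bound_def xs(3) by simp
qed

text \<open>For an optimal \<open>T\<close> with a good guess \<open>h\<close>, the selected guess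
  \<open>g\<close> need not be \<open>h\<close>, but its certified bound is at most that of the set
  found for \<open>h\<close>. This in turn is compared with the bound of \<open>h\<close> for
  \<open>T\<close>, using the min-sum guarantee, and finally with the norm of
  \<open>T\<close>.\<close>

lemma ordered_alg_approx:
  assumes F: "F \<subseteq> Pow (set us)" "F \<noteq> {}" and a: "1 \<le> a"
    and k: "(1 + 1 / real k)\<^sup>2 + 1 / real k \<le> 1 + e"
    and f: "\<And>g. \<exists>S\<in>F. encodes_set (f (query k (environment (inp x)) g)) S \<and>
      real_of_rat (\<Sum>e\<in>S. of_int (penalty k C g (u e)))
        \<le> a * real_of_rat (Min ((\<lambda>S. \<Sum>e\<in>S. of_int (penalty k C g (u e))) ` F))"
  shows "\<exists>S\<in>F. encodes_set (ordered_alg k f (inp x)) S \<and>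
    real_of_rat (norm_of S) \<le> a * (1 + e) * real_of_rat (Min (norm_of ` F))"
proof -
  have finF: "finite F" using F(1) by (rule finite_subset) simp
  define env where "env = environment (inp x)"
  define pen where "pen g S = (\<Sum>e\<in>S. penalty k C g (u e))" for g S
  have "\<forall>g. \<exists>S. S \<in> F \<and> encodes_set (f (query k env g)) S \<and>
      (\<forall>T\<in>F. real_of_int (pen g S) \<le> a * real_of_int (pen g T))"
  proof
    fix g
    have of_int: "(\<Sum>e\<in>S. of_int (penalty k C g (u e))) = rat_of_int (pen g S)" for S by (simp add: pen_def)
    from f[of g] obtain S where S: "S \<in> F" "encodes_set (f (query k env g)) S"
      "real_of_rat (rat_of_int (pen g S)) \<le> a * real_of_rat (Min ((\<lambda>S. rat_of_int (pen g S)) ` F))"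
      unfolding env_def of_int by blast
    have "real_of_int (pen g S) \<le> a * real_of_int (pen g T)" if "T \<in> F" for T
    proof -
      have "Min ((\<lambda>S. rat_of_int (pen g S)) ` F) \<le> rat_of_int (pen g T)" using that finF by (intro Min_le) auto
      then have "real_of_rat (Min ((\<lambda>S. rat_of_int (pen g S)) ` F)) \<le> real_of_rat (rat_of_int (pen g T))"
        by (simp only: of_rat_less_eq)
      then have "a * real_of_rat (Min ((\<lambda>S. rat_of_int (pen g S)) ` F)) \<le> a * real_of_int (pen g T)"
        using a by (intro mult_left_mono) auto
      then show ?thesis using S(3) by simp
    qed
    with S(1,2) show "\<exists>S. S \<in> F \<and> encodes_set (f (query k env g)) S \<and>
      (\<forall>T\<in>F. real_of_int (pen g S) \<le> a * real_of_int (pen g T))" by blast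
  qed
  from choice[OF this] obtain S where S: "\<And>g. S g \<in> F" "\<And>g. encodes_set (f (query k env g)) (S g)"
    "\<And>g T. T \<in> F \<Longrightarrow> real_of_int (pen g (S g)) \<le> a * real_of_int (pen g T)" by blast
  have sub: "T \<subseteq> set us" if "T \<in> F" for T using that F(1) by blast
  have cand: "dint (dfst (candidate k f env g)) = bound g (S g)" for g
    unfolding env_def
    by (rule candidate_value) (use S(2)[of g] sub[OF S(1)[of g]] in \<open>simp_all add: env_def\<close>)
  obtain g where g: "g \<in> set (items (guesses k I))"
    "fold (better k f env) (items (guesses k I)) (Atom 0) = candidate k f env g"
    "\<And>g'. g' \<in> set (items (guesses k I)) \<Longrightarrow> bound g (S g) \<le> bound g' (S g')"
    using fold_better_minimal[OF guesses_nonempty[of k I], of k f env] unfolding cand by blast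
  have "ordered_alg k f (inp x) = f (query k env g)"
    using g(2) by (simp add: ordered_alg_def env_def[symmetric] candidate_def)
      (simp add: env_def environment_def inp_def I_def)
  then have enc: "encodes_set (ordered_alg k f (inp x)) (S g)" using S(2) by simp
  have "Min (norm_of ` F) \<in> norm_of ` F" using finF F(2) by (intro Min_in) auto
  then obtain T where T: "T \<in> F" "Min (norm_of ` F) = norm_of T" by blast
  from bound_le_norm[OF sub[OF T(1)]] obtain h where h: "h \<in> set (items (guesses k I))"
    "real_of_int (bound h T) \<le> ((1 + 1 / real k)\<^sup>2 + 1 / real k) * real_of_rat (scale * norm_of T)" by blast
  have pos: "0 < real_of_rat scale" using scale_pos by simp
  have "scale * norm_of T \<ge> 0"
  proof -
    from ex_ranks[OF sub[OF T(1)]] obtain y where y: "ranks T y" by blast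
    have ws: "0 \<le> ws i" if "i < n" for i
      using sum_nonneg[of "{i..<n}" c] c_nonneg sum_c[of i] that by simp
    have "0 \<le> (\<Sum>i<n. ws i * y i)" using y ws unfolding ranks_def by (intro sum_nonneg mult_nonneg_nonneg) auto
    then have "0 \<le> rat_of_int (\<Sum>i<n. ws i * y i)" by (simp only: of_int_0_le_iff)
    then show ?thesis using y unfolding ranks_def by simp
  qed
  then have nn: "0 \<le> real_of_rat (scale * norm_of T)" by simp
  have "real_of_rat (scale * norm_of (S g)) \<le> real_of_rat (of_int (bound g (S g)))"
    using norm_le_bound[OF sub[OF S(1)[of g]] guess_nonneg[OF g(1)]] by (simp only: of_rat_less_eq)
  also have "\<dots> \<le> real_of_int (bound h (S h))" using g(3)[OF h(1)] by simp
  also have "\<dots> = real_of_int (offset k C h) + real_of_int (pen h (S h))" by (simp add: bound_def pen_def)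
  also have "\<dots> \<le> a * real_of_int (offset k C h) + a * real_of_int (pen h T)"
  proof (rule add_mono)
    \<comment> \<open>The min-sum guarantee concerns the penalties only; the nonnegative offset is
      enlarged to match since \<open>1 \<le> a\<close>.\<close>
    show "real_of_int (offset k C h) \<le> a * real_of_int (offset k C h)"
      using offset_nonneg[OF guess_nonneg[OF h(1)]] a mult_right_mono[of 1 a "real_of_int (offset k C h)"] by simp
  qed (rule S(3)[OF T(1)])
  also have "\<dots> = a * real_of_int (bound h T)" by (simp add: bound_def pen_def distrib_left)
  also have "\<dots> \<le> a * ((1 + e) * real_of_rat (scale * norm_of T))"
    using h(2) mult_right_mono[OF k nn] a by (intro mult_left_mono) auto
  finally have "real_of_rat scale * real_of_rat (norm_of (S g))
      \<le> real_of_rat scale * (a * (1 + e) * real_of_rat (norm_of T))"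
    by (simp add: of_rat_mult mult_ac)
  then have "real_of_rat (norm_of (S g)) \<le> a * (1 + e) * real_of_rat (norm_of T)"
    using pos by (simp only: mult_le_cancel_left_pos)
  with S(1) enc show ?thesis unfolding T(2) by blast
qed

end

theorem theoremC6:
  fixes P :: comb_problem and \<alpha> \<epsilon> :: real
  assumes "combinatorial_problem P"
    and "1 \<le> \<alpha>"
    and "\<exists>c. polytime_approx \<alpha> (min_sum_problem P) c"
    and "0 < \<epsilon>"
  shows "\<exists>c. polytime_approx (\<alpha> * (1 + \<epsilon>)) (ord_norm_problem P) c"
proof -
  obtain k :: nat where k: "4 / \<epsilon> \<le> real k" using real_arch_simple by blast
  have k0: "0 < k"
  proof (rule ccontr)
    assume "\<not> 0 < k"
    with k have "4 / \<epsilon> \<le> 0" by simp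
    moreover have "0 < 4 / \<epsilon>" using assms(4) by simp
    ultimately show False by linarith
  qed
  from assms(3) obtain c where c: "polytime_approx \<alpha> (min_sum_problem P) c" ..
  define f where "f = output_of c"
  obtain p where p: "\<forall>x us v. min_sum_input P x us v \<longrightarrow>
    (\<exists>t. computes c (Node x (enc_values us v)) t (f (Node x (enc_values us v))) \<and>
      t \<le> poly p (dsize (Node x (enc_values us v))))"
    using polytime_approx_min_sumD(1)[OF c] unfolding f_def by blast
  note approx = polytime_approx_min_sumD(2)[OF c, folded f_def]
  \<comment> \<open>\<open>?E\<close> holds the valid min-sum inputs, where the given program is
    reliable, and \<open>?D\<close> the valid inputs of the new one; it remains to see that all
    queries arising from \<open>?D\<close> lie in \<open>?E\<close>.\<close>
  let ?E = "{Node x (enc_values us v) | x us v. min_sum_input P x us v}"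
  let ?D = "{Node x (Node (enc_values us v) (enc_list (map enc_rat w))) | x us v w.
    min_sum_input P x us v \<and> weight_vector (card (ground P x)) w}"
  have inst: "ordered_instance us v w k" if "min_sum_input P x us v" "weight_vector (card (ground P x)) w" for x us v w
  proof
    have "card (ground P x) = length us" using that(1) distinct_card[of us] by (simp add: min_sum_input_def)
    then show "weight_vector (length us) w" using that(2) by simp
  qed (use that(1) k0 in \<open>auto simp: min_sum_input_def\<close>)
  have query: "query k (environment (Node x (Node (enc_values us v) (enc_list (map enc_rat w))))) g =
      Node x (enc_values us (\<lambda>e. of_int (penalty k (ordered_instance.C w) g (ordered_instance.u us v e))))"
    and query_valid: "min_sum_input P x us (\<lambda>e. of_int (penalty k (ordered_instance.C w) g (ordered_instance.u us v e)))"
    if "min_sum_input P x us v" "weight_vector (card (ground P x)) w" for x us v w g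
  proof -
    interpret ordered_instance us v w k using inst[OF that] .
    show "query k (environment (Node x (Node (enc_values us v) (enc_list (map enc_rat w))))) g =
      Node x (enc_values us (\<lambda>e. of_int (penalty k C g (u e))))"
      using query_eq[of x g] by (simp add: inp_def V_def W_def)
    show "min_sum_input P x us (\<lambda>e. of_int (penalty k C g (u e)))"
      using that(1) penalty_nonneg by (simp add: min_sum_input_def)
  qed
  have "ptime ?E f" using p by (intro ptime_of_computes[of _ c f p]) blast
  then have "ptime ?D (ordered_alg k f)"
  proof (rule ptime_ordered_alg[OF k0])
    fix inp g
    assume "inp \<in> ?D"
    then obtain x us v w where *: "inp = Node x (Node (enc_values us v) (enc_list (map enc_rat w)))"
      "min_sum_input P x us v" "weight_vector (card (ground P x)) w" by blast
    show "query k (environment inp) g \<in> ?E"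
      unfolding *(1) query[OF *(2,3)] using query_valid[OF *(2,3)] by blast
  qed
  from ptime_computes[OF this] obtain d q where d: "\<forall>inp\<in>?D.
    \<exists>t. computes d inp t (ordered_alg k f inp) \<and> t \<le> poly q (dsize inp)" by (elim exE)
  have "polytime_approx (\<alpha> * (1 + \<epsilon>)) (ord_norm_problem P) d"
    unfolding polytime_approx_def
  proof (intro exI[of _ q] ballI, clarify)
    fix inp F cost
    assume "(inp, F, cost) \<in> ord_norm_problem P"
    then obtain x us v w where inp: "inp = Node x (Node (enc_values us v) (enc_list (map enc_rat w)))"
      and F: "F = feasible P x" and cost: "cost = (\<lambda>S. ord_norm (ground P x) w (restrict_vec v S))"
      and valid: "min_sum_input P x us v" "weight_vector (card (ground P x)) w"
      unfolding ord_norm_problem_def min_sum_input_def by blast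
    interpret ordered_instance us v w k using inst[OF valid] .
    have "inp \<in> ?D" using inp valid by blast
    from bspec[OF d this] obtain t where t: "computes d inp t (ordered_alg k f inp)" "t \<le> poly q (dsize inp)" by blast
    have inp_eq: "inp = ordered_instance.inp us v w x" by (simp add: inp inp_def V_def W_def)
    have "cost = norm_of" using valid(1) by (simp add: cost norm_of_def fun_eq_iff min_sum_input_def)
    moreover have "\<exists>S\<in>F. encodes_set (ordered_alg k f inp) S \<and>
        real_of_rat (norm_of S) \<le> \<alpha> * (1 + \<epsilon>) * real_of_rat (Min (norm_of ` F))" if "F \<noteq> {}"
      unfolding inp_eq
    proof (rule ordered_alg_approx[OF _ that assms(2) approx_factor[OF assms(4) k k0]])
      show "F \<subseteq> Pow (set us)"
        using assms(1) valid(1) unfolding F combinatorial_problem_def min_sum_input_def by blast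
      show "\<exists>S\<in>F. encodes_set (f (query k (environment (ordered_instance.inp us v w x)) g)) S \<and>
        real_of_rat (\<Sum>e\<in>S. of_int (penalty k C g (u e)))
          \<le> \<alpha> * real_of_rat (Min ((\<lambda>S. \<Sum>e\<in>S. of_int (penalty k C g (u e))) ` F))" for g
        unfolding query_eq F using that F by (intro approx query_valid[OF valid]) simp
    qed
    ultimately have "F \<noteq> {} \<longrightarrow> (\<exists>S\<in>F. encodes_set (ordered_alg k f inp) S \<and>
        real_of_rat (cost S) \<le> \<alpha> * (1 + \<epsilon>) * real_of_rat (Min (cost ` F)))" by simp
    with t show "\<exists>t out. computes d inp t out \<and> t \<le> poly q (dsize inp) \<and> (F \<noteq> {} \<longrightarrow>
      (\<exists>S\<in>F. encodes_set out S \<and> real_of_rat (cost S) \<le> \<alpha> * (1 + \<epsilon>) * real_of_rat (Min (cost ` F))))"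
      by blast
  qed
  then show ?thesis ..
qed

end
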